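(* Let $\mathbf b=(b_1,b_2)\in\mathbb N^2$ with $\gcd(b_1,b_2)=1$, let $0<\alpha<1$, and let $\mathcal W=\{(u_j,v_j):1\le j\le J\}\subset\mathbb Z^2$ be a set of $J$ distinct lattice points satisfying condition $( * )$ and with $J<2^{b_1+b_2}$. Let $(P_i)_{i\ge0}$ be an $\alpha$-random walk, let $X_i=1$ if $P_i$ is $\mathbf b$-visible from every point of $\mathcal W$ and $X_i=0$ otherwise, and let $\overline S(n)=\frac1n\sum_{i=1}^n X_i$. Then almost surely $$\lim_{n\to\infty}\overline S(n)=\prod_{p}\Big(1-\frac{J}{p^{b_1+b_2}}\Big),$$ where $p$ runs over all primes.
   Context: $\mathbf b$-visibility: given two distinct lattice points $P=(p_1,p_2)$, $Q=(q_1,q_2)\in\mathbb Z^2$, they determine a curve through both of the form $a_1(y-q_2)^{b_1}=a_2(x-q_1)^{b_2}$ for some $(a_1,a_2)\in\mathbb Q^2\setminus\{(0,0)\}$; $P$ is called $\mathbf b$-visible from $Q$ if no other lattice point lies on the segment of this curve between $P$ and $Q$. (This relation is symmetric.) Condition $( * )$ on a finite set $\mathcal W\subset\mathbb Z^2$: distinct points of $\mathcal W$ are pairwise $\mathbf b$-visible from each other. An $\alpha$-random walk ($0<\alpha<1$) starting at the origin is defined by $P_0=(0,0)$ and $P_{i+1}=P_i+(1,0)$ with probability $\alpha$, $P_{i+1}=P_i+(0,1)$ with probability $1-\alpha$, the steps being independent. *)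

theory Defs
  imports "HOL-Probability.Probability" "HOL-Computational_Algebra.Primes"
begin

definition on_b_curve :: "nat \<times> nat \<Rightarrow> rat \<Rightarrow> rat \<Rightarrow> int \<times> int \<Rightarrow> int \<times> int \<Rightarrow> bool" where
  "on_b_curve b a1 a2 Q R \<longleftrightarrow>
     a1 * (of_int (snd R - snd Q)) ^ (fst b) = a2 * (of_int (fst R - fst Q)) ^ (snd b)"

text \<open>R lies in the closed axis-parallel box spanned by P and Q; on the curve
  through P and Q this is exactly the segment of the curve between P and Q.\<close>
definition in_box :: "int \<times> int \<Rightarrow> int \<times> int \<Rightarrow> int \<times> int \<Rightarrow> bool" where
  "in_box P Q R \<longleftrightarrow>
     min (fst P) (fst Q) \<le> fst R \<and> fst R \<le> max (fst P) (fst Q) \<and>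
     min (snd P) (snd Q) \<le> snd R \<and> snd R \<le> max (snd P) (snd Q)"

definition b_visible :: "nat \<times> nat \<Rightarrow> int \<times> int \<Rightarrow> int \<times> int \<Rightarrow> bool" where
  "b_visible b P Q \<longleftrightarrow> P \<noteq> Q \<and>
     (\<exists>a1 a2 :: rat. (a1 \<noteq> 0 \<or> a2 \<noteq> 0) \<and> on_b_curve b a1 a2 Q P \<and>
        \<not> (\<exists>R. R \<noteq> P \<and> R \<noteq> Q \<and> in_box P Q R \<and> on_b_curve b a1 a2 Q R))"

definition cond_star :: "nat \<times> nat \<Rightarrow> (int \<times> int) set \<Rightarrow> bool" where
  "cond_star b W \<longleftrightarrow> (\<forall>P\<in>W. \<forall>Q\<in>W. P \<noteq> Q \<longrightarrow> b_visible b P Q)"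

fun walk :: "(nat \<Rightarrow> 'a \<Rightarrow> bool) \<Rightarrow> nat \<Rightarrow> 'a \<Rightarrow> int \<times> int" where
  "walk \<xi> 0 \<omega> = (0, 0)"
| "walk \<xi> (Suc i) \<omega> = walk \<xi> i \<omega> + (if \<xi> i \<omega> then (1, 0) else (0, 1))"

end

theory Submission
  imports Defs
begin

text \<open>
  A point with both coordinate differences \<open>d\<^sub>1, d\<^sub>2\<close> to \<open>w\<close> nonzero is \<open>b\<close>-visible from \<open>w\<close> iff
  no prime \<open>p\<close> satisfies \<open>p ^ b1 dvd d\<^sub>1\<close> and \<open>p ^ b2 dvd d\<^sub>2\<close>; so visibility from all of \<open>W\<close> means
  avoiding, for each prime, \<open>card W\<close> residue classes, which are distinct because of condition (*).

  For a nontrivial additive character \<open>\<chi>\<close> modulo \<open>N\<close> the increments of \<open>\<chi>(P\<^sub>i)\<close> are multiplicative and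
  independent, so the second moment of \<open>\<Sum>i\<le>n. \<chi>(P\<^sub>i)\<close> is a double geometric series of size
  \<open>O(N\<^sup>2 n)\<close>.  Hence the frequency of a residue class modulo \<open>N\<close> differs from \<open>1 / N\<^sup>2\<close> by
  \<open>O(N / sqrt n)\<close> in mean.  Along \<open>n = K ^ 12\<close> this is summable even after summation over all moduli
  up to \<open>K\<^sup>2\<close>, which makes the contribution of the primes between \<open>T\<close> and \<open>K\<^sup>2\<close> at most \<open>card W / T + o(1)\<close>.
  For primes above \<open>K\<^sup>2\<close> the first moment suffices: \<open>p\<close> must divide \<open>i - (fst w + snd w)\<close>, and the
  first coordinate lies in a given class modulo \<open>p\<close> with probability \<open>1 / p + O(ln p / sqrt i)\<close>.
  Consecutive values of \<open>K ^ 12\<close> have ratio tending to 1, so monotonicity of the counts gives the full limit.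
\<close>

section \<open>Visibility and prime divisors\<close>

text \<open>If such a prime existed, dividing the displacement from \<open>Q\<close> to
  \<open>P\<close> by \<open>(p ^ b1, p ^ b2)\<close> would give a blocking lattice point: both
  sides of the curve equation carry the same factor \<open>p ^ (b1 * b2)\<close>, whatever the
  coefficients are. One coordinate difference may vanish here.\<close>

lemma b_visible_imp_no_prime:
  assumes vis: "b_visible (b1, b2) P Q" and b: "b1 \<ge> 1" "b2 \<ge> 1" and p: "prime (p::nat)"
  shows "\<not> (int p ^ b1 dvd fst P - fst Q \<and> int p ^ b2 dvd snd P - snd Q)"
proof
  assume "int p ^ b1 dvd fst P - fst Q \<and> int p ^ b2 dvd snd P - snd Q"
  then obtain e1 e2 where e: "fst P - fst Q = int p ^ b1 * e1" "snd P - snd Q = int p ^ b2 * e2"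
    by (auto elim!: dvdE)
  have gt: "int p ^ b1 > 1" "int p ^ b2 > 1"
    using b prime_gt_1_nat[OF p] by (auto intro!: one_less_power)
  define R where "R = (fst Q + e1, snd Q + e2)"
  obtain a1 a2 :: rat where a: "a1 \<noteq> 0 \<or> a2 \<noteq> 0" "on_b_curve (b1, b2) a1 a2 Q P"
    and no: "\<not> (\<exists>R. R \<noteq> P \<and> R \<noteq> Q \<and> in_box P Q R \<and> on_b_curve (b1, b2) a1 a2 Q R)"
    and PQ: "P \<noteq> Q"
    using vis by (auto simp: b_visible_def)
  have e0: "e1 \<noteq> 0 \<or> e2 \<noteq> 0" using e PQ by (auto simp: prod_eq_iff)
  have between: "min (q + c * e) q \<le> q + e \<and> q + e \<le> max (q + c * e) q" if "c > 1" for q c e :: int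
  proof (cases "e \<ge> 0")
    case True
    with that have "1 * e \<le> c * e" by (intro mult_right_mono) auto
    with True show ?thesis by auto
  next
    case False
    with that have "c * e \<le> e" using mult_right_mono_neg[of 1 c e] by simp
    hence "min (q + c * e) q \<le> q + e" by (meson add_left_mono min.coboundedI1)
    moreover have "q + e \<le> max (q + c * e) q" using False by (simp add: le_max_iff_disj)
    ultimately show ?thesis ..
  qed
  have P: "fst P = fst Q + int p ^ b1 * e1" "snd P = snd Q + int p ^ b2 * e2" using e by auto
  have "R \<noteq> Q" using e0 by (auto simp: R_def prod_eq_iff)
  moreover have "R \<noteq> P" using e0 gt P by (auto simp: R_def prod_eq_iff)
  moreover have "in_box P Q R"
    unfolding in_box_def R_def P using between[OF gt(1), of "fst Q" e1] between[OF gt(2), of "snd Q" e2] by simp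
  moreover have "on_b_curve (b1, b2) a1 a2 Q R"
  proof -
    have "a1 * (of_int (int p ^ b2 * e2)) ^ b1 = a2 * (of_int (int p ^ b1 * e1)) ^ b2"
      using a(2) by (simp add: on_b_curve_def e)
    hence "(of_nat p) ^ (b1 * b2) * (a1 * of_int e2 ^ b1) = (of_nat p) ^ (b1 * b2) * (a2 * of_int e1 ^ b2)"
      by (simp add: power_mult_distrib flip: power_mult) (simp add: algebra_simps)
    hence "a1 * of_int e2 ^ b1 = a2 * of_int e1 ^ b2"
      using prime_gt_0_nat[OF p] by simp
    thus ?thesis by (simp add: on_b_curve_def R_def)
  qed
  ultimately show False using no by blast
qed

text \<open>Here \<open>d1, d2\<close> and \<open>r1, r2\<close> stand for the absolute differences
  from \<open>Q\<close> of the endpoint and of an intermediate point. As \<open>d1\<close> cannot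
  divide \<open>r1\<close>, some prime has larger multiplicity in \<open>d1\<close>. If
  \<open>e\<close> and \<open>f\<close> are the drops in multiplicity from \<open>d1\<close> to
  \<open>r1\<close> and from \<open>d2\<close> to \<open>r2\<close>, then \<open>eq\<close> gives
  \<open>b2 * e = b1 * f\<close>, and coprimality forces \<open>b1\<close> to divide
  \<open>e\<close> and \<open>b2\<close> to divide \<open>f\<close>.\<close>

lemma curve_point_imp_prime:
  fixes d1 d2 r1 r2 :: nat
  assumes b: "b1 \<ge> 1" "b2 \<ge> 1" "coprime b1 b2"
    and r: "0 < r1" "0 < r2" "r1 < d1" "0 < d2"
    and eq: "d1 ^ b2 * r2 ^ b1 = d2 ^ b1 * r1 ^ b2"
  shows "\<exists>p. prime p \<and> p ^ b1 dvd d1 \<and> p ^ b2 dvd d2"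
proof -
  have "\<not> d1 dvd r1" using r by (auto dest: dvd_imp_le)
  then obtain p where p: "prime p" "multiplicity p d1 > multiplicity p r1"
    using r multiplicity_le_imp_dvd[of d1 r1] by (metis gr_implies_not0 not_le)
  have "multiplicity p (d1 ^ b2 * r2 ^ b1) = b2 * multiplicity p d1 + b1 * multiplicity p r2"
    using r p by (simp add: prime_elem_multiplicity_mult_distrib prime_elem_multiplicity_power_distrib)
  moreover have "multiplicity p (d2 ^ b1 * r1 ^ b2) = b1 * multiplicity p d2 + b2 * multiplicity p r1"
    using r p by (simp add: prime_elem_multiplicity_mult_distrib prime_elem_multiplicity_power_distrib)
  ultimately have *: "b2 * multiplicity p d1 + b1 * multiplicity p r2 = b1 * multiplicity p d2 + b2 * multiplicity p r1"
    using eq by simp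
  define e f where "e = multiplicity p d1 - multiplicity p r1" and "f = multiplicity p d2 - multiplicity p r2"
  have e: "e > 0" "multiplicity p d1 = multiplicity p r1 + e" using p by (auto simp: e_def)
  have 1: "b2 * e + b1 * multiplicity p r2 = b1 * multiplicity p d2" using * e by (simp add: algebra_simps)
  have "b1 * multiplicity p r2 \<le> b1 * multiplicity p d2" using 1 by linarith
  hence f: "multiplicity p d2 = multiplicity p r2 + f" using b by (simp add: f_def)
  have ef: "b2 * e = b1 * f" using 1 f by (simp add: algebra_simps)
  have "b1 dvd e" using ef b by (metis coprime_dvd_mult_right_iff dvd_triv_left)
  have "b2 dvd f" using ef b by (metis coprime_commute coprime_dvd_mult_right_iff dvd_triv_left)
  moreover have "f > 0" using ef e b by (metis gr0I mult_is_0 not_one_le_zero)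
  ultimately have "b1 \<le> e" "b2 \<le> f" using \<open>b1 dvd e\<close> e by (auto dest: dvd_imp_le)
  hence "b1 \<le> multiplicity p d1" "b2 \<le> multiplicity p d2" using e f by auto
  thus ?thesis using p multiplicity_dvd' by blast
qed

text \<open>The coefficients \<open>d1 ^ b2\<close> and \<open>d2 ^ b1\<close> give a curve through
  \<open>P\<close>, and any further lattice point on its segment would produce a forbidden prime by
  \<open>curve_point_imp_prime\<close>. Both differences being nonzero, this curve meets the axes
  through \<open>Q\<close> only in \<open>Q\<close>.\<close>

lemma no_prime_imp_b_visible:
  assumes b: "b1 \<ge> 1" "b2 \<ge> 1" "coprime b1 b2"
    and ne: "fst P \<noteq> fst Q" "snd P \<noteq> snd Q"
    and no: "\<And>p. prime (p::nat) \<Longrightarrow> \<not> (int p ^ b1 dvd fst P - fst Q \<and> int p ^ b2 dvd snd P - snd Q)"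
  shows "b_visible (b1, b2) P Q"
proof -
  define d1 d2 where "d1 = fst P - fst Q" and "d2 = snd P - snd Q"
  have d0: "d1 \<noteq> 0" "d2 \<noteq> 0" using ne by (auto simp: d1_def d2_def)
  have False if R: "R \<noteq> P" "R \<noteq> Q" "in_box P Q R"
    "on_b_curve (b1, b2) (of_int (d1 ^ b2)) (of_int (d2 ^ b1)) Q R" for R
  proof -
    define r1 r2 where "r1 = fst R - fst Q" and "r2 = snd R - snd Q"
    have "(of_int (d1 ^ b2 * r2 ^ b1) :: rat) = of_int (d2 ^ b1 * r1 ^ b2)"
      using R(4) by (simp add: on_b_curve_def r1_def r2_def)
    hence eq: "d1 ^ b2 * r2 ^ b1 = d2 ^ b1 * r1 ^ b2" by (simp only: of_int_eq_iff)
    \<comment> \<open>The box supplies a size bound and agreement in sign with the full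
      displacement. The sign later separates \<open>R = P\<close> from the mirror images of
      \<open>P\<close>.\<close>
    have between: "nat \<bar>r - q\<bar> \<le> nat \<bar>p - q\<bar> \<and> (r - q) * (p - q) \<ge> 0"
      if "min p q \<le> r" "r \<le> max p q" for p q r :: int
    proof (cases "q \<le> p")
      case True
      with that have "q \<le> r" "r \<le> p" by (simp_all add: min_absorb2 max_absorb1)
      thus ?thesis using True by simp
    next
      case False
      with that have "p \<le> r" "r \<le> q" by (simp_all add: min_absorb1 max_absorb2)
      thus ?thesis using False by (simp add: mult_nonpos_nonpos)
    qed
    have box: "nat \<bar>r1\<bar> \<le> nat \<bar>d1\<bar>" "nat \<bar>r2\<bar> \<le> nat \<bar>d2\<bar>"
      and sg: "r1 * d1 \<ge> 0" "r2 * d2 \<ge> 0"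
      using R(3) between unfolding in_box_def r1_def r2_def d1_def d2_def by blast+
    have "r1 = 0 \<longleftrightarrow> r2 = 0" using eq d0 b by (auto simp: power_0_left)
    with R(2) have r0: "r1 \<noteq> 0" "r2 \<noteq> 0" by (auto simp: r1_def r2_def prod_eq_iff)
    have "nat \<bar>d1 ^ b2 * r2 ^ b1\<bar> = nat \<bar>d2 ^ b1 * r1 ^ b2\<bar>" using eq by simp
    hence eqn: "nat \<bar>d1\<bar> ^ b2 * nat \<bar>r2\<bar> ^ b1 = nat \<bar>d2\<bar> ^ b1 * nat \<bar>r1\<bar> ^ b2"
      by (simp add: abs_mult power_abs nat_mult_distrib nat_power_eq)
    \<comment> \<open>Equality in the first coordinate would pass through the curve equation to the
      second and force \<open>R = P\<close>.\<close>
    have "nat \<bar>r1\<bar> < nat \<bar>d1\<bar>"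
    proof (rule ccontr)
      assume "\<not> nat \<bar>r1\<bar> < nat \<bar>d1\<bar>"
      hence a: "nat \<bar>r1\<bar> = nat \<bar>d1\<bar>" using box by linarith
      have "nat \<bar>r2\<bar> ^ b1 = nat \<bar>d2\<bar> ^ b1" using eqn d0 unfolding a by simp
      hence "nat \<bar>r2\<bar> = nat \<bar>d2\<bar>" using b by (simp add: power_eq_iff_eq_base)
      with a have "\<bar>r1\<bar> = \<bar>d1\<bar>" "\<bar>r2\<bar> = \<bar>d2\<bar>"
        by (simp_all only: eq_nat_nat_iff abs_ge_zero)
      with sg d0 have "r1 = d1" "r2 = d2" by (auto simp: abs_eq_iff mult_less_0_iff zero_le_mult_iff)
      with R(1) show False by (auto simp: r1_def r2_def d1_def d2_def prod_eq_iff)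
    qed
    then obtain p where p: "prime p" "p ^ b1 dvd nat \<bar>d1\<bar>" "p ^ b2 dvd nat \<bar>d2\<bar>"
      using curve_point_imp_prime[OF b, of "nat \<bar>r1\<bar>" "nat \<bar>r2\<bar>" "nat \<bar>d1\<bar>" "nat \<bar>d2\<bar>"] eqn r0 d0 by auto
    hence "int p ^ b1 dvd d1" "int p ^ b2 dvd d2" by (simp_all flip: of_nat_power add: int_dvd_int_iff)
    with no[OF p(1)] show False by (auto simp: d1_def d2_def)
  qed
  moreover have "on_b_curve (b1, b2) (of_int (d1 ^ b2)) (of_int (d2 ^ b1)) Q P"
    by (simp add: on_b_curve_def d1_def d2_def mult.commute)
  moreover have "P \<noteq> Q" using ne by auto
  moreover have "(of_int (d1 ^ b2) :: rat) \<noteq> 0" using d0 by simp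
  ultimately show ?thesis unfolding b_visible_def by blast
qed

section \<open>Counting residue classes\<close>

text \<open>Coprimality gives injectivity; surjectivity then follows from equal
  cardinalities.\<close>

lemma bij_betw_chinese_remainder:
  fixes m n :: int
  assumes "coprime m n" "m > 0" "n > 0"
  shows "bij_betw (\<lambda>x. (x mod m, x mod n)) {0..<m * n} ({0..<m} \<times> {0..<n})"
proof -
  let ?f = "\<lambda>x. (x mod m, x mod n)"
  have inj: "inj_on ?f {0..<m * n}"
  proof (rule inj_onI)
    fix x y assume xy: "x \<in> {0..<m * n}" "y \<in> {0..<m * n}" and "?f x = ?f y"
    hence "m dvd x - y" "n dvd x - y" by (auto simp: mod_eq_dvd_iff)
    hence "m * n dvd x - y" using assms by (simp add: divides_mult)
    hence "x mod (m * n) = y mod (m * n)" by (simp add: mod_eq_dvd_iff)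
    thus "x = y" using xy by simp
  qed
  have "?f ` {0..<m * n} = {0..<m} \<times> {0..<n}"
  proof (rule card_subset_eq)
    show "card (?f ` {0..<m * n}) = card ({0..<m} \<times> {0..<n})"
      using assms by (simp add: card_image[OF inj] card_cartesian_product nat_mult_distrib)
  qed (use assms in auto)
  with inj show ?thesis by (simp add: bij_betw_def)
qed

text \<open>Conditions to coprime moduli are independent: the Chinese remainder theorem is applied
  to each of the two coordinates. This is what turns the density into a product over primes.\<close>

lemma card_periodic_conj:
  fixes m n :: int and A B :: "int \<Rightarrow> int \<Rightarrow> bool"
  assumes mn: "coprime m n" "m > 0" "n > 0"
    and A: "\<And>x y. A (x mod m) (y mod m) = A x y" and B: "\<And>x y. B (x mod n) (y mod n) = B x y"
  shows "card {z \<in> {0..<m * n} \<times> {0..<m * n}. A (fst z) (snd z) \<and> B (fst z) (snd z)} =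
    card {z \<in> {0..<m} \<times> {0..<m}. A (fst z) (snd z)} * card {z \<in> {0..<n} \<times> {0..<n}. B (fst z) (snd z)}"
proof -
  define f where "f = (\<lambda>x. (x mod m, x mod n))"
  \<comment> \<open>The four residues of a point are regrouped into one pair modulo \<open>m\<close>
    and one pair modulo \<open>n\<close>.\<close>
  define g where "g = (\<lambda>z. ((fst (f (fst z)), fst (f (snd z))), (snd (f (fst z)), snd (f (snd z)))))"
  have f: "bij_betw f {0..<m * n} ({0..<m} \<times> {0..<n})"
    unfolding f_def by (rule bij_betw_chinese_remainder[OF mn])
  have "bij_betw g {z \<in> {0..<m * n} \<times> {0..<m * n}. A (fst z) (snd z) \<and> B (fst z) (snd z)}
     ({z \<in> {0..<m} \<times> {0..<m}. A (fst z) (snd z)} \<times> {z \<in> {0..<n} \<times> {0..<n}. B (fst z) (snd z)})"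
    unfolding bij_betw_def
  proof (intro conjI inj_onI)
    fix z z' assume "z \<in> {z \<in> {0..<m * n} \<times> {0..<m * n}. A (fst z) (snd z) \<and> B (fst z) (snd z)}"
      "z' \<in> {z \<in> {0..<m * n} \<times> {0..<m * n}. A (fst z) (snd z) \<and> B (fst z) (snd z)}" "g z = g z'"
    hence "f (fst z) = f (fst z')" "f (snd z) = f (snd z')"
      "fst z \<in> {0..<m * n}" "fst z' \<in> {0..<m * n}" "snd z \<in> {0..<m * n}" "snd z' \<in> {0..<m * n}"
      by (auto simp: g_def prod_eq_iff)
    thus "z = z'"
      using inj_onD[OF bij_betw_imp_inj_on[OF f]] by (intro prod_eqI) blast+
  next
    show "g ` {z \<in> {0..<m * n} \<times> {0..<m * n}. A (fst z) (snd z) \<and> B (fst z) (snd z)} =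
      {z \<in> {0..<m} \<times> {0..<m}. A (fst z) (snd z)} \<times> {z \<in> {0..<n} \<times> {0..<n}. B (fst z) (snd z)}"
    proof (intro equalityI subsetI)
      fix t assume "t \<in> g ` {z \<in> {0..<m * n} \<times> {0..<m * n}. A (fst z) (snd z) \<and> B (fst z) (snd z)}"
      thus "t \<in> {z \<in> {0..<m} \<times> {0..<m}. A (fst z) (snd z)} \<times> {z \<in> {0..<n} \<times> {0..<n}. B (fst z) (snd z)}"
        using mn by (auto simp: g_def f_def A B)
    next
      fix t assume t: "t \<in> {z \<in> {0..<m} \<times> {0..<m}. A (fst z) (snd z)} \<times> {z \<in> {0..<n} \<times> {0..<n}. B (fst z) (snd z)}"
      obtain x y x' y' where t_eq: "t = ((x, y), (x', y'))" by (metis prod.exhaust)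
      have "(x, x') \<in> f ` {0..<m * n}" "(y, y') \<in> f ` {0..<m * n}"
        using t f by (auto simp: t_eq bij_betw_def)
      then obtain u v where uv: "u \<in> {0..<m * n}" "v \<in> {0..<m * n}" "f u = (x, x')" "f v = (y, y')"
        by (metis imageE)
      hence "g (u, v) = t" by (simp add: g_def t_eq)
      moreover have "A u v" "B u v" using t uv A[of u v] B[of u v] by (auto simp: t_eq f_def)
      ultimately show "t \<in> g ` {z \<in> {0..<m * n} \<times> {0..<m * n}. A (fst z) (snd z) \<and> B (fst z) (snd z)}"
        using uv by force
    qed
  qed
  from bij_betw_same_card[OF this] show ?thesis by (simp add: card_cartesian_product)
qed

lemma card_residue_class:
  fixes d e u :: int
  assumes "d > 0" "e \<ge> 0"
  shows "card {x \<in> {0..<d * e}. d dvd x - u} = nat e"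
proof -
  have "bij_betw (\<lambda>k. d * k + u mod d) {0..<e} {x \<in> {0..<d * e}. d dvd x - u}"
  proof (rule bij_betw_byWitness[where f' = "\<lambda>x. x div d"])
    show "(\<lambda>k. d * k + u mod d) ` {0..<e} \<subseteq> {x \<in> {0..<d * e}. d dvd x - u}"
    proof
      fix x assume "x \<in> (\<lambda>k. d * k + u mod d) ` {0..<e}"
      then obtain k where k: "0 \<le> k" "k < e" "x = d * k + u mod d" by auto
      have "d * (k + 1) \<le> d * e" using k assms by (intro mult_left_mono) auto
      moreover have "0 \<le> u mod d" "u mod d < d" using assms by auto
      moreover have "d dvd x - u" using k by (simp add: mod_eq_dvd_iff[symmetric])
      moreover have "0 \<le> d * k" using k assms by simp
      ultimately show "x \<in> {x \<in> {0..<d * e}. d dvd x - u}" using k by (simp add: algebra_simps)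
    qed
    show "(\<lambda>x. x div d) ` {x \<in> {0..<d * e}. d dvd x - u} \<subseteq> {0..<e}"
    proof
      fix k assume "k \<in> (\<lambda>x. x div d) ` {x \<in> {0..<d * e}. d dvd x - u}"
      then obtain x where x: "0 \<le> x" "x < e * d" "k = x div d" by (auto simp: mult.commute)
      have "k * d \<le> x" using assms by (simp add: x minus_mod_eq_div_mult[symmetric])
      hence "k * d < e * d" using x by linarith
      hence "k < e" using assms by simp
      thus "k \<in> {0..<e}" using assms x by (simp add: pos_imp_zdiv_nonneg_iff)
    qed
    show "\<forall>x\<in>{x \<in> {0..<d * e}. d dvd x - u}. d * (x div d) + u mod d = x"
      by (auto simp: mod_eq_dvd_iff[symmetric]) (metis mult_div_mod_eq)
  qed (use assms in auto)
  from bij_betw_same_card[OF this] show ?thesis by simp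
qed

text \<open>The sieve form of visibility, restricted to the primes in \<open>F\<close>. For finite
  \<open>F\<close> it is a periodic condition, whereas visibility itself is not.\<close>

definition avoids :: "nat \<Rightarrow> nat \<Rightarrow> (int \<times> int) set \<Rightarrow> nat set \<Rightarrow> int \<times> int \<Rightarrow> bool" where
  "avoids b1 b2 W F z \<longleftrightarrow>
     (\<forall>p\<in>F. \<forall>w\<in>W. \<not> (int p ^ b1 dvd fst z - fst w \<and> int p ^ b2 dvd snd z - snd w))"

text \<open>\<open>p ^ (b1 + b2)\<close> is a common multiple of \<open>p ^ b1\<close> and
  \<open>p ^ b2\<close>, so one modulus serves both coordinates.\<close>

lemma avoids_mod:
  assumes "\<And>p. p \<in> F \<Longrightarrow> int p ^ (b1 + b2) dvd N"
  shows "avoids b1 b2 W F (fst z mod N, snd z mod N) = avoids b1 b2 W F z"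
proof -
  have per: "(int p ^ c dvd x mod N - a) = (int p ^ c dvd x - a)" if "int p ^ c dvd N" for p c x a
    using that by (simp add: mod_eq_dvd_iff[symmetric] mod_mod_cancel)
  have "int p ^ b1 dvd N" "int p ^ b2 dvd N" if "p \<in> F" for p
    using assms[OF that] unfolding power_add by (blast intro: dvd_trans dvd_triv_left dvd_triv_right)+
  thus ?thesis by (simp add: avoids_def per)
qed

text \<open>Each \<open>w\<close> rules out \<open>p ^ b2\<close> choices of the first coordinate
  and \<open>p ^ b1\<close> of the second, hence \<open>q\<close> pairs. By \<open>dist\<close> the
  excluded sets of different \<open>w\<close> are disjoint, which leaves
  \<open>q ^ 2 - card W * q\<close> pairs.\<close>

lemma card_avoiding_residues_prime:
  fixes W :: "(int \<times> int) set"
  assumes p: "prime (p::nat)" and W: "finite W"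
    and dist: "\<And>w w'. w \<in> W \<Longrightarrow> w' \<in> W \<Longrightarrow> w \<noteq> w' \<Longrightarrow>
       \<not> (int p ^ b1 dvd fst w - fst w' \<and> int p ^ b2 dvd snd w - snd w')"
  defines "q \<equiv> int p ^ (b1 + b2)"
  shows "real (card {z \<in> {0..<q} \<times> {0..<q}. avoids b1 b2 W {p} z})
         = (real_of_int q)\<^sup>2 * (1 - card W / real p ^ (b1 + b2))"
proof -
  have p0: "int p > 0" using prime_gt_0_nat[OF p] by simp
  have q0: "q > 0" using p0 by (simp add: q_def)
  define B where "B = (\<lambda>w. {x \<in> {0..<q}. int p ^ b1 dvd x - fst w} \<times> {y \<in> {0..<q}. int p ^ b2 dvd y - snd w})"
  have cB: "card (B w) = nat q" for w
  proof -
    have "card {x \<in> {0..<q}. int p ^ b1 dvd x - fst w} = nat (int p ^ b2)"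
      unfolding q_def power_add using p0 by (intro card_residue_class) auto
    moreover have "card {x \<in> {0..<q}. int p ^ b2 dvd x - snd w} = nat (int p ^ b1)"
      unfolding q_def power_add mult.commute[of "int p ^ b1"] using p0 by (intro card_residue_class) auto
    ultimately show ?thesis
      by (simp add: B_def card_cartesian_product q_def power_add nat_mult_distrib)
  qed
  have disj: "B w \<inter> B w' = {}" if "w \<in> W" "w' \<in> W" "w \<noteq> w'" for w w'
  proof (rule ccontr)
    assume "B w \<inter> B w' \<noteq> {}"
    then obtain x y where "int p ^ b1 dvd x - fst w" "int p ^ b1 dvd x - fst w'"
       "int p ^ b2 dvd y - snd w" "int p ^ b2 dvd y - snd w'" by (auto simp: B_def)
    hence "int p ^ b1 dvd (x - fst w') - (x - fst w)" "int p ^ b2 dvd (y - snd w') - (y - snd w)"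
      by (blast intro: dvd_diff)+
    with dist[OF that] show False by simp
  qed
  have fin: "finite (B w)" for w
    unfolding B_def by (rule finite_subset[of _ "{0..<q} \<times> {0..<q}"]) auto
  have "card (\<Union>w\<in>W. B w) = (\<Sum>w\<in>W. card (B w))"
    using W fin disj by (intro card_UN_disjoint) auto
  hence cU: "card (\<Union>w\<in>W. B w) = card W * nat q" by (simp add: cB)
  have L: "{z \<in> {0..<q} \<times> {0..<q}. avoids b1 b2 W {p} z}
     = {0..<q} \<times> {0..<q} - (\<Union>w\<in>W. B w)" (is "?L = _") by (auto simp: B_def avoids_def)
  have "card ?L = card ({0..<q} \<times> {0..<q}) - card (\<Union>w\<in>W. B w)"
    unfolding L
  proof (rule card_Diff_subset)
    show "finite (\<Union>w\<in>W. B w)" using W fin by auto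
    show "(\<Union>w\<in>W. B w) \<subseteq> {0..<q} \<times> {0..<q}" by (auto simp: B_def)
  qed
  moreover have "card (\<Union>w\<in>W. B w) \<le> card ({0..<q} \<times> {0..<q})"
    by (intro card_mono) (auto simp: B_def)
  ultimately have "real (card ?L) = real (card ({0..<q} \<times> {0..<q})) - real (card (\<Union>w\<in>W. B w))" by simp
  also have "\<dots> = (real_of_int q)\<^sup>2 - card W * real_of_int q"
    using q0 by (simp add: cU card_cartesian_product power2_eq_square)
  also have "\<dots> = (real_of_int q)\<^sup>2 * (1 - card W / real_of_int q)"
    using q0 by (simp add: power2_eq_square field_simps)
  also have "real_of_int q = real p ^ (b1 + b2)" by (simp add: q_def)
  finally show ?thesis by (simp add: q_def)
qed

text \<open>Induction over the primes: \<open>card_periodic_conj\<close> splits off one prime power,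
  which is coprime to the product of the others.\<close>

lemma card_avoiding_residues:
  fixes W :: "(int \<times> int) set"
  assumes F: "finite F" "\<And>p. p \<in> F \<Longrightarrow> prime (p::nat)" and W: "finite W"
    and dist: "\<And>w w' p. w \<in> W \<Longrightarrow> w' \<in> W \<Longrightarrow> w \<noteq> w' \<Longrightarrow> prime p \<Longrightarrow>
       \<not> (int p ^ b1 dvd fst w - fst w' \<and> int p ^ b2 dvd snd w - snd w')"
  defines "N \<equiv> \<lambda>F. \<Prod>p\<in>F. int p ^ (b1 + b2)"
  shows "real (card {z \<in> {0..<N F} \<times> {0..<N F}. avoids b1 b2 W F z})
         = (real_of_int (N F))\<^sup>2 * (\<Prod>p\<in>F. 1 - card W / real p ^ (b1 + b2))"
  using F
proof (induction F rule: finite_induct)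
  case empty
  have "{0..<1::int} \<times> {0..<1::int} = {(0,0)}" by auto
  thus ?case by (simp add: N_def avoids_def)
next
  case (insert p F)
  let ?q = "int p ^ (b1 + b2)"
  have p: "prime p" using insert by auto
  have q0: "?q > 0" using prime_gt_0_nat[OF p] by simp
  have N0: "N F > 0" unfolding N_def using insert.prems prime_gt_0_nat by (intro prod_pos) auto
  have cop: "coprime ?q (N F)"
    unfolding N_def
  proof (intro prod_coprime_right)
    fix r assume "r \<in> F"
    hence "coprime p r" using insert by (intro primes_coprime) auto
    thus "coprime ?q (int r ^ (b1 + b2))" by simp
  qed
  have dvd: "int r ^ (b1 + b2) dvd N F" if "r \<in> F" for r
    using that insert.hyps unfolding N_def by (intro dvd_prodI) auto
  have N': "N (insert p F) = ?q * N F" using insert.hyps by (simp add: N_def)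
  have set_eq: "{z \<in> {0..<N (insert p F)} \<times> {0..<N (insert p F)}. avoids b1 b2 W (insert p F) z} =
    {z \<in> {0..<?q * N F} \<times> {0..<?q * N F}. avoids b1 b2 W {p} (fst z, snd z) \<and> avoids b1 b2 W F (fst z, snd z)}"
    unfolding N' by (auto simp: avoids_def)
  have "card {z \<in> {0..<?q * N F} \<times> {0..<?q * N F}.
      avoids b1 b2 W {p} (fst z, snd z) \<and> avoids b1 b2 W F (fst z, snd z)} =
    card {z \<in> {0..<?q} \<times> {0..<?q}. avoids b1 b2 W {p} (fst z, snd z)} *
    card {z \<in> {0..<N F} \<times> {0..<N F}. avoids b1 b2 W F (fst z, snd z)}"
  proof (rule card_periodic_conj[OF cop q0 N0])
    show "avoids b1 b2 W {p} (x mod ?q, y mod ?q) = avoids b1 b2 W {p} (x, y)" for x y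
      using avoids_mod[of "{p}" b1 b2 ?q W "(x, y)"] by simp
    show "avoids b1 b2 W F (x mod N F, y mod N F) = avoids b1 b2 W F (x, y)" for x y
      using avoids_mod[of F b1 b2 "N F" W "(x, y)"] dvd by simp
  qed
  hence c: "card {z \<in> {0..<N (insert p F)} \<times> {0..<N (insert p F)}. avoids b1 b2 W (insert p F) z} =
    card {z \<in> {0..<?q} \<times> {0..<?q}. avoids b1 b2 W {p} z} *
    card {z \<in> {0..<N F} \<times> {0..<N F}. avoids b1 b2 W F z}" unfolding set_eq prod.collapse .
  have "real (card {z \<in> {0..<N (insert p F)} \<times> {0..<N (insert p F)}. avoids b1 b2 W (insert p F) z}) =
    real (card {z \<in> {0..<?q} \<times> {0..<?q}. avoids b1 b2 W {p} z}) *
    real (card {z \<in> {0..<N F} \<times> {0..<N F}. avoids b1 b2 W F z})" unfolding c of_nat_mult ..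
  also have "real (card {z \<in> {0..<?q} \<times> {0..<?q}. avoids b1 b2 W {p} z}) =
     (real_of_int ?q)\<^sup>2 * (1 - card W / real p ^ (b1 + b2))"
    by (rule card_avoiding_residues_prime[OF p W dist[OF _ _ _ p]])
  also have "real (card {z \<in> {0..<N F} \<times> {0..<N F}. avoids b1 b2 W F z}) =
     (real_of_int (N F))\<^sup>2 * (\<Prod>p\<in>F. 1 - card W / real p ^ (b1 + b2))"
    by (rule insert.IH) (use insert.prems in auto)
  finally show ?case using insert.hyps by (simp add: N' power_mult_distrib)
qed

text \<open>Exactly one residue pair represents \<open>z\<close>, and periodicity decides whether it
  survives the sieve. This reduces sieve frequencies to frequencies of single residue
  classes.\<close>

lemma avoids_eq_sum_residues:
  assumes N: "N > 0" and F: "\<And>p. p \<in> F \<Longrightarrow> int p ^ (b1 + b2) dvd int N"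
  shows "(of_bool (avoids b1 b2 W F z) :: real) =
    (\<Sum>r\<in>{r \<in> {0..<int N} \<times> {0..<int N}. avoids b1 b2 W F r}.
       of_bool (int N dvd fst z - fst r \<and> int N dvd snd z - snd r))"
proof -
  define R where "R = {r \<in> {0..<int N} \<times> {0..<int N}. avoids b1 b2 W F r}"
  define r0 where "r0 = (fst z mod int N, snd z mod int N)"
  have finR: "finite R" unfolding R_def by (rule finite_subset[of _ "{0..<int N} \<times> {0..<int N}"]) auto
  have "(\<Sum>r\<in>R. of_bool (int N dvd fst z - fst r \<and> int N dvd snd z - snd r)) =
    (\<Sum>r\<in>R. if r = r0 then 1 else 0 :: real)"
  proof (rule sum.cong)
    fix r assume "r \<in> R"
    hence "fst r mod int N = fst r" "snd r mod int N = snd r" by (auto simp: R_def)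
    hence "int N dvd fst z - fst r \<and> int N dvd snd z - snd r \<longleftrightarrow> r = r0"
      by (auto simp: mod_eq_dvd_iff[symmetric] r0_def prod_eq_iff)
    thus "of_bool (int N dvd fst z - fst r \<and> int N dvd snd z - snd r) = (if r = r0 then 1 else 0 :: real)"
      by simp
  qed simp
  also have "\<dots> = of_bool (r0 \<in> R)" using finR by simp
  also have "r0 \<in> R \<longleftrightarrow> avoids b1 b2 W F z"
    using N avoids_mod[of F b1 b2 "int N" W z] F by (auto simp: R_def r0_def)
  finally show ?thesis by (simp add: R_def)
qed

section \<open>Elementary estimates\<close>

text \<open>Orthogonality of additive characters modulo \<open>m\<close>: a geometric sum whose
  ratio is an \<open>m\<close>-th root of unity.\<close>

lemma sum_cis_eq_indicator:
  fixes m :: nat and z :: int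
  assumes m: "m > 0"
  shows "(\<Sum>k<m. cis (2 * pi * real k * real_of_int z / real m)) = (if int m dvd z then of_nat m else 0)"
proof -
  define w where "w = cis (2 * pi * real_of_int z / real m)"
  have "w ^ k = cis (2 * pi * real k * real_of_int z / real m)" for k
    unfolding w_def Complex.DeMoivre by (rule arg_cong[where f = cis]) (simp add: field_simps)
  hence "(\<Sum>k<m. cis (2 * pi * real k * real_of_int z / real m)) = (\<Sum>k<m. w ^ k)" by simp
  also have "\<dots> = (if w = 1 then of_nat m else (1 - w ^ m) / (1 - w))" by (rule sum_gp_strict)
  also have "w ^ m = 1"
    using m unfolding w_def Complex.DeMoivre by (simp add: cis_multiple_2pi)
  also have "w = 1 \<longleftrightarrow> int m dvd z"
  proof
    assume "w = 1"
    hence "cos (2 * pi * real_of_int z / real m) = 1" by (simp add: w_def complex_eq_iff)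
    then obtain n :: int where "2 * pi * real_of_int z / real m = n * 2 * pi" unfolding cos_one_2pi_int by auto
    hence "real_of_int z = real_of_int (n * int m)" using m by (simp add: field_simps)
    hence "z = n * int m" by (simp only: of_int_eq_iff)
    thus "int m dvd z" by simp
  next
    assume "int m dvd z"
    then obtain c where "z = int m * c" by auto
    thus "w = 1" using m cis_multiple_2pi[of "real_of_int c"] by (simp add: w_def mult.assoc)
  qed
  finally show ?thesis by simp
qed

text \<open>Jordan's inequality: the sine is concave and lies above its chord from \<open>0\<close>
  to \<open>pi / 2\<close>.\<close>

lemma sin_ge_linear:
  assumes "0 \<le> x" "x \<le> pi / 2"
  shows "sin x \<ge> 2 * x / pi"
proof -
  have conv: "convex_on {0..pi} (\<lambda>x. - sin x)"
  proof (rule f''_ge0_imp_convex)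
    show "((\<lambda>x. - sin x) has_real_derivative - cos x) (at x)" for x
      by (auto intro!: derivative_eq_intros)
    show "((\<lambda>x. - cos x) has_real_derivative sin x) (at x)" for x
      by (auto intro!: derivative_eq_intros)
    show "sin x \<ge> 0" if "x \<in> {0..pi}" for x using that by (auto intro: sin_ge_zero)
  qed auto
  have "- sin ((1 - 2 * x / pi) *\<^sub>R 0 + (2 * x / pi) *\<^sub>R (pi / 2)) \<le>
    (1 - 2 * x / pi) * - sin 0 + (2 * x / pi) * - sin (pi / 2)"
    using assms by (intro convex_onD[OF conv]) (auto simp: field_simps)
  thus ?thesis by simp
qed

text \<open>By symmetry \<open>k\<close> may be replaced by its distance \<open>j\<close> to the
  nearest multiple of \<open>m\<close>. Then \<open>1 - cos (2 * x) = 2 * (sin x)^2\<close> and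
  Jordan's inequality give \<open>2 * (2 * j / m)^2\<close>.\<close>

lemma one_minus_cos_ge:
  fixes k m :: nat
  assumes "0 < k" "k < m"
  shows "1 - cos (2 * pi * real k / real m) \<ge> 8 * (real (min k (m - k)) / real m)\<^sup>2"
proof -
  define j where "j = min k (m - k)"
  have j: "2 * j \<le> m" using assms by (auto simp: j_def)
  have "cos (2 * pi * real k / real m) = cos (2 * pi * real j / real m)"
  proof (cases "j = k")
    case False
    hence "j = m - k" by (auto simp: j_def)
    hence "2 * pi * real j / real m = 2 * pi - 2 * pi * real k / real m"
      using assms by (simp add: of_nat_diff field_simps)
    thus ?thesis by simp
  qed auto
  also have "1 - \<dots> = 2 * (sin (pi * real j / real m))\<^sup>2"
    using cos_double_sin[of "pi * real j / real m"] by (simp add: mult.assoc)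
  also have "\<dots> \<ge> 2 * (2 * (pi * real j / real m) / pi)\<^sup>2"
  proof -
    have "2 * (pi * real j / real m) / pi \<le> sin (pi * real j / real m)"
    proof (rule sin_ge_linear)
      have "real (2 * j) \<le> real m" using j by (simp only: of_nat_le_iff)
      thus "pi * real j / real m \<le> pi / 2" using assms by (simp add: field_simps)
    qed auto
    thus ?thesis by (intro mult_left_mono power_mono) auto
  qed
  finally show ?thesis by (simp add: j_def power_divide power_mult_distrib)
qed

text \<open>The spectral gap of the walk modulo \<open>N\<close>. The real part is a convex
  combination of two terms \<open>1 - cos\<close>, and a nontrivial frequency makes at least one of
  them of size \<open>8 / N^2\<close>.\<close>

lemma cmod_one_minus_char_ge:
  fixes a b N :: nat and \<alpha> :: real
  assumes ab: "a < N" "b < N" "(a, b) \<noteq> (0, 0)" and \<alpha>: "0 < \<alpha>" "\<alpha> < 1"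
  shows "cmod (1 - (\<alpha> * cis (2 * pi * real a / real N) + (1 - \<alpha>) * cis (2 * pi * real b / real N)))
    \<ge> min \<alpha> (1 - \<alpha>) * 8 / (real N)\<^sup>2"
proof -
  let ?ca = "1 - cos (2 * pi * real a / real N)" and ?cb = "1 - cos (2 * pi * real b / real N)"
  have ge: "8 / (real N)\<^sup>2 \<le> 1 - cos (2 * pi * real k / real N)" if "0 < k" "k < N" for k
  proof -
    have "(1 / real N)\<^sup>2 \<le> (real (min k (N - k)) / real N)\<^sup>2"
      using that by (intro power_mono divide_right_mono) auto
    with one_minus_cos_ge[OF that] show ?thesis by (simp add: power_divide)
  qed
  have nn: "?ca \<ge> 0" "?cb \<ge> 0" by auto
  have "min \<alpha> (1 - \<alpha>) * (8 / (real N)\<^sup>2) \<le> \<alpha> * ?ca + (1 - \<alpha>) * ?cb"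
  proof (cases "a = 0")
    case True
    have "min \<alpha> (1 - \<alpha>) * (8 / (real N)\<^sup>2) \<le> (1 - \<alpha>) * ?cb"
      using ab True \<alpha> by (intro mult_mono ge) auto
    thus ?thesis using \<alpha> nn by (simp add: True)
  next
    case False
    have "min \<alpha> (1 - \<alpha>) * (8 / (real N)\<^sup>2) \<le> \<alpha> * ?ca"
      using ab False \<alpha> by (intro mult_mono ge) auto
    moreover have "(1 - \<alpha>) * ?cb \<ge> 0" using \<alpha> nn by (intro mult_nonneg_nonneg) auto
    ultimately show ?thesis by linarith
  qed
  also have "\<dots> = Re (1 - (\<alpha> * cis (2 * pi * real a / real N) + (1 - \<alpha>) * cis (2 * pi * real b / real N)))"
    by (simp add: algebra_simps)
  also have "\<dots> \<le> cmod (1 - (\<alpha> * cis (2 * pi * real a / real N) + (1 - \<alpha>) * cis (2 * pi * real b / real N)))"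
    by (rule complex_Re_le_cmod)
  finally show ?thesis by simp
qed

text \<open>A crude bound that replaces Gaussian decay by \<open>1 / t\<close>; summed over
  frequencies it costs only a logarithm.\<close>

lemma exp_minus_square_le:
  fixes t :: real
  assumes "t > 0"
  shows "exp (- t\<^sup>2) \<le> 1 / t"
proof -
  have "t \<le> 1 + t\<^sup>2"
    using sum_squares_ge_zero[of "t - 1/2" 0] by (simp add: power2_eq_square algebra_simps)
  also have "\<dots> \<le> exp (t\<^sup>2)" by (rule exp_ge_add_one_self)
  finally have "t \<le> exp (t\<^sup>2)" .
  hence "inverse (exp (t\<^sup>2)) \<le> inverse t" using assms by (intro le_imp_inverse_le)
  thus ?thesis by (simp add: exp_minus field_simps)
qed

text \<open>The squared modulus equals \<open>1 - 2 * \<alpha> * (1 - \<alpha>) * (1 - cos)\<close>,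
  so \<open>1 - x \<le> exp (- x)\<close> bounds the \<open>i\<close>-th power by
  \<open>exp (- t^2)\<close> with \<open>t\<close> proportional to \<open>sqrt i * j / m\<close>.
  The sum of two reciprocals dominates \<open>1 / j\<close>, where
  \<open>j = min k (m - k)\<close>.\<close>

lemma cmod_bernoulli_char_power_le:
  fixes k m i :: nat and \<alpha> :: real
  assumes k: "0 < k" "k < m" and i: "i > 0" and \<alpha>: "0 < \<alpha>" "\<alpha> < 1"
  shows "cmod (\<alpha> * cis (2 * pi * real k / real m) + (1 - \<alpha>)) ^ i
    \<le> real m * (1 / real k + 1 / real (m - k)) / sqrt (8 * \<alpha> * (1 - \<alpha>) * real i)"
proof -
  define j where "j = min k (m - k)"
  have j0: "j > 0" using k by (simp add: j_def)
  define c where "c = cos (2 * pi * real k / real m)"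
  define t where "t = sqrt (8 * \<alpha> * (1 - \<alpha>) * real i) * (real j / real m)"
  have pos: "8 * \<alpha> * (1 - \<alpha>) * real i > 0" using \<alpha> i by simp
  have t0: "t > 0" using pos j0 k unfolding t_def by (intro mult_pos_pos) auto
  define r where "r = cmod (\<alpha> * cis (2 * pi * real k / real m) + (1 - \<alpha>))"
  have "r\<^sup>2 = 1 - 2 * \<alpha> * (1 - \<alpha>) * (1 - c)"
  proof -
    have s: "(sin (2 * pi * real k / real m))\<^sup>2 = 1 - c\<^sup>2"
      unfolding c_def by (simp add: sin_squared_eq)
    have "r\<^sup>2 = (\<alpha> * c + (1 - \<alpha>))\<^sup>2 + \<alpha>\<^sup>2 * (sin (2 * pi * real k / real m))\<^sup>2"
      unfolding r_def cmod_power2 c_def by (simp add: power_mult_distrib)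
    thus ?thesis unfolding s by (simp add: power2_eq_square algebra_simps)
  qed
  also have "\<dots> \<le> 1 - 2 * (8 * \<alpha> * (1 - \<alpha>) * (real j / real m)\<^sup>2)"
  proof -
    have "2 * \<alpha> * (1 - \<alpha>) * (8 * (real j / real m)\<^sup>2) \<le> 2 * \<alpha> * (1 - \<alpha>) * (1 - c)"
      using \<alpha> one_minus_cos_ge[OF k] unfolding j_def c_def by (intro mult_left_mono) auto
    thus ?thesis by (simp add: algebra_simps)
  qed
  also have "\<dots> \<le> exp (- (2 * (8 * \<alpha> * (1 - \<alpha>) * (real j / real m)\<^sup>2)))"
    using exp_ge_add_one_self[of "- (2 * (8 * \<alpha> * (1 - \<alpha>) * (real j / real m)\<^sup>2))"] by simp
  finally have "(r\<^sup>2) ^ i \<le> exp (- (2 * (8 * \<alpha> * (1 - \<alpha>) * (real j / real m)\<^sup>2))) ^ i"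
    by (intro power_mono) auto
  also have "\<dots> = exp (- (2 * t\<^sup>2))"
  proof -
    have "t\<^sup>2 = 8 * \<alpha> * (1 - \<alpha>) * real i * (real j / real m)\<^sup>2"
      using pos unfolding t_def power_mult_distrib by (subst real_sqrt_pow2) auto
    thus ?thesis unfolding exp_of_nat_mult[symmetric] by (simp add: mult_ac)
  qed
  also have "\<dots> = (exp (- t\<^sup>2))\<^sup>2" by (simp add: exp_double[symmetric])
  finally have "(r ^ i)\<^sup>2 \<le> (exp (- t\<^sup>2))\<^sup>2" by (simp add: power_mult[symmetric] mult.commute)
  hence "r ^ i \<le> exp (- t\<^sup>2)" by (rule power2_le_imp_le) simp
  also have "\<dots> \<le> 1 / t" by (rule exp_minus_square_le[OF t0])
  also have "\<dots> = real m * (1 / real j) / sqrt (8 * \<alpha> * (1 - \<alpha>) * real i)" by (simp add: t_def)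
  also have "\<dots> \<le> real m * (1 / real k + 1 / real (m - k)) / sqrt (8 * \<alpha> * (1 - \<alpha>) * real i)"
    using pos k by (intro divide_right_mono mult_left_mono) (auto simp: j_def min_def)
  finally show ?thesis by (simp add: r_def)
qed

lemma sum_inverse_le_ln:
  assumes "m > 0"
  shows "(\<Sum>k = 1..<m. 1 / real k + 1 / real (m - k)) \<le> 2 * (1 + ln (real m))"
proof -
  have "(\<Sum>k = 1..<m. 1 / real (m - k)) = (\<Sum>k = 1..<m. 1 / real k)"
    by (rule sum.reindex_bij_witness[of _ "\<lambda>k. m - k" "\<lambda>k. m - k"]) auto
  moreover have "(\<Sum>k = 1..<m. 1 / real k) \<le> harm m"
    unfolding harm_def by (auto intro!: sum_mono2 simp: divide_inverse)
  \<comment> \<open>The difference of harmonic number and logarithm decreases from its value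
    \<open>1\<close> at \<open>m = 1\<close>.\<close>
  moreover have "harm m - ln (real m) \<le> harm 1 - ln (real 1)"
    using assms by (intro euler_mascheroni_sequence_decreasing) auto
  ultimately show ?thesis by (simp add: sum.distrib harm_def)
qed

lemma sum_inverse_sqrt_le: "(\<Sum>i = 1..n. 1 / sqrt (real i)) \<le> 2 * sqrt (real n)"
proof (induction n)
  case (Suc n)
  \<comment> \<open>Telescoping: each term is at most twice an increment of the square root.\<close>
  have "1 / sqrt (real (Suc n)) \<le> 2 * (sqrt (real (Suc n)) - sqrt (real n))"
  proof -
    define a b where "a = sqrt (real (Suc n))" and "b = sqrt (real n)"
    have ab: "a > 0" "b \<ge> 0" "b \<le> a" "a\<^sup>2 - b\<^sup>2 = 1" by (auto simp: a_def b_def)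
    have "1 = (a - b) * (a + b)" using ab by (simp add: power2_eq_square algebra_simps)
    also have "\<dots> \<le> (a - b) * (2 * a)" using ab by (intro mult_left_mono) auto
    finally show ?thesis using ab(1) unfolding a_def[symmetric] b_def[symmetric] by (simp add: field_simps)
  qed
  thus ?case using Suc by simp
qed simp

lemma sum_inverse_square_le:
  assumes "T \<ge> 1"
  shows "(\<Sum>p = Suc T..L. 1 / (real p)\<^sup>2) \<le> 1 / real T"
proof -
  \<comment> \<open>Telescoping against \<open>1 / L - 1 / (L + 1)\<close>; the \<open>max\<close>
    makes the bound \<open>0\<close> as long as the range of summation is empty.\<close>
  have "(\<Sum>p = Suc T..L. 1 / (real p)\<^sup>2) \<le> 1 / real T - 1 / real (max T L)"
  proof (induction L)
    case (Suc L)
    show ?case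
    proof (cases "T \<le> L")
      case True
      have "1 / (real (Suc L))\<^sup>2 \<le> 1 / (real L * real (Suc L))"
        using True assms by (intro divide_left_mono) (auto simp: power2_eq_square mult_right_mono)
      also have "\<dots> = 1 / real L - 1 / real (Suc L)" using True assms by (simp add: field_simps)
      finally show ?thesis using Suc True by (simp add: max_def)
    next
      case False
      hence "max T (Suc L) = T" by simp
      thus ?thesis using False by simp
    qed
  qed (auto simp: max_def)
  also have "\<dots> \<le> 1 / real T" by simp
  finally show ?thesis .
qed

text \<open>Every prime factor is at least \<open>2\<close>, so \<open>2\<close> to the number of
  prime factors is at most \<open>m\<close>.\<close>

lemma card_prime_divisors_le:
  fixes m :: nat
  assumes "m > 0"
  shows "real (card {p. prime p \<and> p dvd m}) * ln 2 \<le> ln (real m)"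
proof -
  have eq: "{p. prime p \<and> p dvd m} = prime_factors m" using assms by (auto simp: prime_factors_dvd)
  have "2 ^ card (prime_factors m) = (\<Prod>p\<in>prime_factors m. 2::nat)" by simp
  also have "\<dots> \<le> (\<Prod>p\<in>prime_factors m. p ^ multiplicity p m)"
  proof (rule prod_mono)
    fix p assume p: "p \<in> prime_factors m"
    hence "2 \<le> p" "multiplicity p m \<ge> 1"
      using assms prime_ge_2_nat by (auto simp: prime_factors_multiplicity)
    hence "p ^ 1 \<le> p ^ multiplicity p m" by (intro power_increasing) auto
    thus "0 \<le> (2::nat) \<and> 2 \<le> p ^ multiplicity p m" using \<open>2 \<le> p\<close> by simp
  qed
  also have "\<dots> = m" using prime_factorization_nat[of m] assms by simp
  finally have "real (2 ^ card (prime_factors m)) \<le> real m" by (simp only: of_nat_le_iff)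
  hence "ln (2 ^ card (prime_factors m)) \<le> ln (real m)" by (intro ln_mono) auto
  thus ?thesis by (simp add: eq ln_realpow)
qed

section \<open>Tools for almost sure limits and for passing to the full sequence\<close>

text \<open>The expectations are summable, so by monotone convergence the series of the
  \<open>Y k\<close> is almost surely finite and its terms tend to zero. All error terms below are
  handled in this way.\<close>

lemma AE_tendsto_zero:
  fixes Y :: "nat \<Rightarrow> 'a \<Rightarrow> real"
  assumes int: "\<And>k. integrable M (Y k)" and nonneg: "\<And>k \<omega>. 0 \<le> Y k \<omega>"
    and le: "\<And>k. (\<integral>\<omega>. Y k \<omega> \<partial>M) \<le> C / (real (Suc k))\<^sup>2"
  shows "AE \<omega> in M. (\<lambda>k. Y k \<omega>) \<longlonglongrightarrow> 0"
proof -
  have [measurable]: "Y k \<in> borel_measurable M" for k using int by auto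
  have sum: "summable (\<lambda>k. C / (real (Suc k))\<^sup>2)"
  proof -
    have "summable (\<lambda>k. inverse ((real k)\<^sup>2))" by (rule inverse_power_summable) simp
    hence "summable (\<lambda>k. inverse ((real (Suc k))\<^sup>2))" by (subst summable_Suc_iff)
    from summable_mult[OF this, of C] show ?thesis by (simp add: divide_inverse)
  qed
  have C0: "0 \<le> C / (real (Suc k))\<^sup>2" for k
    using order_trans[OF integral_nonneg_AE le[of k]] nonneg by auto
  have "(\<Sum>k. ennreal (C / (real (Suc k))\<^sup>2)) = ennreal (\<Sum>k. C / (real (Suc k))\<^sup>2)"
    by (rule suminf_ennreal2[OF C0 sum])
  hence "(\<Sum>k. ennreal (C / (real (Suc k))\<^sup>2)) \<noteq> \<infinity>"
    by (metis ennreal_neq_top infinity_ennreal_def)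
  moreover have "(\<integral>\<^sup>+\<omega>. (\<Sum>k. ennreal (Y k \<omega>)) \<partial>M) = (\<Sum>k. (\<integral>\<^sup>+\<omega>. ennreal (Y k \<omega>) \<partial>M))"
    by (rule nn_integral_suminf) measurable
  moreover have "\<dots> \<le> (\<Sum>k. ennreal (C / (real (Suc k))\<^sup>2))"
  proof (rule suminf_le)
    show "(\<integral>\<^sup>+\<omega>. ennreal (Y k \<omega>) \<partial>M) \<le> ennreal (C / (real (Suc k))\<^sup>2)" for k
      using nn_integral_eq_integral[OF int[of k]] nonneg le[of k] by (simp add: ennreal_leI)
  qed auto
  ultimately have "(\<integral>\<^sup>+\<omega>. (\<Sum>k. ennreal (Y k \<omega>)) \<partial>M) \<noteq> \<infinity>" by (auto simp: top_unique)
  hence "AE \<omega> in M. (\<Sum>k. ennreal (Y k \<omega>)) \<noteq> \<infinity>" by (intro nn_integral_PInf_AE) measurable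
  thus ?thesis
    by eventually_elim (use nonneg in \<open>auto intro!: summable_LIMSEQ_zero summable_suminf_not_top\<close>)
qed

text \<open>An interchange of limits: \<open>T\<close> is fixed first so that \<open>q T\<close> is
  close to \<open>l\<close> and \<open>c / T\<close> is small, and only then \<open>k\<close> is
  sent to infinity. The error \<open>e\<close> must not depend on \<open>T\<close>.\<close>

lemma tendsto_squeeze_family:
  fixes a :: "nat \<Rightarrow> nat \<Rightarrow> real"
  assumes a: "\<And>T. T \<ge> 1 \<Longrightarrow> a T \<longlonglongrightarrow> q T" and q: "q \<longlonglongrightarrow> l" and e: "e \<longlonglongrightarrow> 0"
    and up: "\<And>T k. T \<ge> 1 \<Longrightarrow> v k \<le> a T k" and low: "\<And>T k. T \<ge> 1 \<Longrightarrow> a T k - e k - c / real T \<le> v k"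
  shows "v \<longlonglongrightarrow> l"
proof (rule LIMSEQ_I)
  fix r :: real assume r: "r > 0"
  hence r4: "r / 4 > 0" by simp
  have cT: "(\<lambda>T. c / real T) \<longlonglongrightarrow> 0" by (rule lim_const_over_n)
  have "\<forall>\<^sub>F T in sequentially. \<bar>q T - l\<bar> < r / 4" "\<forall>\<^sub>F T in sequentially. \<bar>c / real T\<bar> < r / 4"
    using tendstoD[OF q r4] tendstoD[OF cT r4] by (simp_all only: dist_real_def diff_zero)
  hence ev: "\<forall>\<^sub>F T in sequentially. \<bar>q T - l\<bar> < r / 4 \<and> \<bar>c / real T\<bar> < r / 4 \<and> T \<ge> 1"
    using eventually_ge_at_top[of 1] by eventually_elim auto
  then obtain T where T: "\<bar>q T - l\<bar> < r / 4" "\<bar>c / real T\<bar> < r / 4" "T \<ge> 1"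
    using eventually_happens'[OF sequentially_bot ev] by auto
  have "\<forall>\<^sub>F k in sequentially. \<bar>a T k - q T\<bar> < r / 4" "\<forall>\<^sub>F k in sequentially. \<bar>e k\<bar> < r / 4"
    using tendstoD[OF a[OF T(3)] r4] tendstoD[OF e r4] by (simp_all only: dist_real_def diff_zero)
  hence "\<forall>\<^sub>F k in sequentially. norm (v k - l) < r"
  proof eventually_elim
    case (elim k)
    thus ?case using T up[OF T(3), of k] low[OF T(3), of k]
      unfolding real_norm_def abs_less_iff by linarith
  qed
  thus "\<exists>no. \<forall>n\<ge>no. norm (v n - l) < r" by (simp add: eventually_sequentially)
qed

text \<open>For \<open>n\<close> between consecutive sampling times, monotonicity bounds
  \<open>S n\<close> by the values at both ends. Exchanging the denominators costs the ratio of
  these times, which tends to \<open>1\<close>.\<close>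

lemma tendsto_average_of_subseq:
  fixes S :: "nat \<Rightarrow> real"
  assumes mono: "\<And>m n. m \<le> n \<Longrightarrow> S m \<le> S n" and nonneg: "\<And>n. 0 \<le> S n" and d: "d > 0"
    and lim: "(\<lambda>k. S (Suc k ^ d) / real (Suc k ^ d)) \<longlonglongrightarrow> l"
  shows "(\<lambda>n. S n / real n) \<longlonglongrightarrow> l"
proof -
  define N where "N = (\<lambda>k::nat. Suc k ^ d)"
  \<comment> \<open>The index of the last sampling time up to \<open>n\<close>. For
    \<open>n = 0\<close> there is none, hence the condition \<open>n \<ge> 1\<close> in
    \<open>k1\<close>.\<close>
  define k where "k = (\<lambda>n. Max {k. N k \<le> n})"
  have N_gt: "k < N k" for k unfolding N_def using self_le_power[of "Suc k" d] d by simp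
  have fin: "finite {k. N k \<le> n}" for n
  proof (rule finite_subset)
    show "{k. N k \<le> n} \<subseteq> {..n}"
    proof
      fix j assume "j \<in> {k. N k \<le> n}"
      thus "j \<in> {..n}" using N_gt[of j] by simp
    qed
  qed simp
  have k1: "N (k n) \<le> n" if "n \<ge> 1" for n
  proof -
    have "k n \<in> {k. N k \<le> n}" unfolding k_def
      using that by (intro Max_in fin) (auto simp: N_def intro!: exI[of _ 0])
    thus ?thesis by simp
  qed
  have k2: "n < N (Suc (k n))" for n
  proof (rule ccontr)
    assume "\<not> n < N (Suc (k n))"
    hence "Suc (k n) \<le> k n" unfolding k_def by (intro Max_ge fin) auto
    thus False by simp
  qed
  have k_lim: "filterlim k at_top sequentially"
    unfolding filterlim_at_top
  proof
    fix Z
    show "\<forall>\<^sub>F n in sequentially. Z \<le> k n"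
      using eventually_ge_at_top[of "N Z"]
    proof eventually_elim
      case (elim n)
      thus ?case unfolding k_def by (intro Max_ge fin) auto
    qed
  qed
  define a where "a = (\<lambda>k. S (N k) / real (N k))"
  define \<rho> where "\<rho> = (\<lambda>k. real (N k) / real (N (Suc k)))"
  have N0: "real (N k) > 0" for k by (simp add: N_def)
  have a: "a \<longlonglongrightarrow> l" using lim by (simp add: a_def N_def)
  have \<rho>: "\<rho> \<longlonglongrightarrow> 1"
  proof -
    have "(\<lambda>k. real (Suc k) / real (Suc (Suc k))) \<longlonglongrightarrow> 1"
      using LIMSEQ_Suc[OF LIMSEQ_n_over_Suc_n] by simp
    hence "(\<lambda>k. (real (Suc k) / real (Suc (Suc k))) ^ d) \<longlonglongrightarrow> 1 ^ d" by (rule tendsto_power)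
    thus ?thesis by (simp add: \<rho>_def N_def power_divide del: of_nat_Suc)
  qed
  have low: "(\<lambda>n. a (k n) * \<rho> (k n)) \<longlonglongrightarrow> l"
    using filterlim_compose[OF tendsto_mult[OF a \<rho>] k_lim] by simp
  have up: "(\<lambda>n. a (Suc (k n)) / \<rho> (k n)) \<longlonglongrightarrow> l"
    using filterlim_compose[OF tendsto_divide[OF LIMSEQ_Suc[OF a] \<rho>] k_lim] by simp
  have ev: "\<forall>\<^sub>F n in sequentially. a (k n) * \<rho> (k n) \<le> S n / real n \<and> S n / real n \<le> a (Suc (k n)) / \<rho> (k n)"
    using eventually_ge_at_top[of 1]
  proof eventually_elim
    case (elim n)
    have "a (k n) * \<rho> (k n) = S (N (k n)) / real (N (Suc (k n)))" using N0[of "k n"] by (simp add: a_def \<rho>_def)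
    also have "\<dots> \<le> S n / real n"
      using elim k1[OF elim] k2[of n] nonneg by (intro frac_le mono) auto
    finally have 1: "a (k n) * \<rho> (k n) \<le> S n / real n" .
    have "S n / real n \<le> S (N (Suc (k n))) / real (N (k n))"
      using elim k1[OF elim] k2[of n] nonneg N0 by (intro frac_le mono) auto
    also have "\<dots> = a (Suc (k n)) / \<rho> (k n)" using N0[of "Suc (k n)"] by (simp add: a_def \<rho>_def)
    finally show ?case using 1 by simp
  qed
  show ?thesis
    by (rule tendsto_sandwich[OF _ _ low up]) (use ev in \<open>auto elim: eventually_mono\<close>)
qed

text \<open>The product converges absolutely by comparison with the series of
  \<open>1 / p ^ c\<close>, so its partial products converge to \<open>prodinf\<close>.\<close>

lemma prime_product_tendsto:
  fixes J :: real
  assumes "c \<ge> 2"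
  shows "(\<lambda>T. \<Prod>p | prime p \<and> p \<le> T. 1 - J / real p ^ c) \<longlonglongrightarrow>
    prodinf (\<lambda>p. if prime p then 1 - J / real p ^ c else 1)"
proof -
  let ?f = "\<lambda>p::nat. if prime p then 1 - J / real p ^ c else 1"
  have "summable (\<lambda>p. \<bar>J\<bar> * inverse (real p ^ c))"
    using assms by (intro summable_mult inverse_power_summable)
  hence "summable (\<lambda>p. norm (?f p - 1))"
    by (rule summable_comparison_test') (auto simp: divide_inverse abs_mult)
  hence "convergent_prod ?f"
    by (intro abs_convergent_prod_imp_convergent_prod summable_imp_abs_convergent_prod)
  hence "(\<lambda>T. \<Prod>p\<le>T. ?f p) \<longlonglongrightarrow> prodinf ?f" by (rule convergent_prod_LIMSEQ)
  moreover have "(\<Prod>p\<le>T. ?f p) = (\<Prod>p | prime p \<and> p \<le> T. 1 - J / real p ^ c)" for T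
    by (subst prod.inter_filter[symmetric]) (auto intro!: prod.cong)
  ultimately show ?thesis by simp
qed

lemma sqrt_twelfth_power: "sqrt (real (a ^ 12)) = real a ^ 6"
  by (rule real_sqrt_unique) simp_all

section \<open>Primes too large for the second moment bound\<close>

text \<open>Starting after \<open>s0\<close> makes \<open>i - s\<close> positive, so the quotients
  \<open>(i - s) / p\<close> are distinct integers from \<open>1\<close> to
  \<open>(n + s0) / p\<close>; no rounding term arises.\<close>

lemma card_multiples_le:
  fixes s :: int and p :: nat
  assumes p: "p > 0" and s: "\<bar>s\<bar> \<le> int s0"
  shows "real (card {i \<in> {s0<..n}. int p dvd int i - s}) \<le> real (n + s0) / real p"
proof -
  have "card {i \<in> {s0<..n}. int p dvd int i - s} \<le> card {1..int (n + s0) div int p}"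
  proof (rule card_inj_on_le[where f = "\<lambda>i. (int i - s) div int p"])
    show "inj_on (\<lambda>i. (int i - s) div int p) {i \<in> {s0<..n}. int p dvd int i - s}"
      using p by (intro inj_onI) (auto elim!: dvdE)
    show "(\<lambda>i. (int i - s) div int p) ` {i \<in> {s0<..n}. int p dvd int i - s} \<subseteq> {1..int (n + s0) div int p}"
    proof clarsimp
      fix i assume i: "s0 < i" "i \<le> n" "int p dvd int i - s"
      hence "0 < int i - s" "int i - s \<le> int (n + s0)" using s by auto
      hence "(int i - s) div int p \<le> int (n + s0) div int p" using p by (intro zdiv_mono1) auto
      moreover have "0 < (int i - s) div int p"
      proof -
        obtain c where c: "int i - s = int p * c" using i(3) by (elim dvdE)
        with \<open>0 < int i - s\<close> have "0 < int p * c" by simp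
        hence "0 < c" using p by (simp add: zero_less_mult_iff)
        thus ?thesis using p by (simp add: c)
      qed
      ultimately show "1 \<le> (int i - s) div int p \<and> (int i - s) div int p \<le> (int n + int s0) div int p" by simp
    qed
  qed auto
  also have "\<dots> = nat (int (n + s0) div int p)" by simp
  also have "int (n + s0) div int p = int ((n + s0) div p)" by (simp add: zdiv_int)
  finally have "real (card {i \<in> {s0<..n}. int p dvd int i - s}) \<le> real ((n + s0) div p)" by simp
  also have "\<dots> \<le> real (n + s0) / real p" by (rule of_nat_div_le_of_nat)
  finally show ?thesis .
qed

text \<open>The coordinates of the walk at time \<open>i\<close> add up to \<open>i\<close>, so a
  prime dividing both differences to \<open>w\<close> divides \<open>i - s\<close> with
  \<open>s = fst w + snd w\<close>. The candidates thus form a deterministic set, independent of the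
  path.\<close>

definition large_primes :: "nat \<Rightarrow> int \<Rightarrow> nat \<Rightarrow> nat set" where
  "large_primes L s i = {p. prime p \<and> L < p \<and> int p dvd int i - s}"

text \<open>For \<open>i > s0\<close> the number \<open>i - s\<close> is positive and at most
  \<open>n + s0\<close>. Its prime divisors are therefore bounded in size and at most logarithmic in
  number.\<close>

lemma large_primes_bound:
  assumes "\<bar>s\<bar> \<le> int s0" "s0 < i" "i \<le> n"
  shows "large_primes L s i \<subseteq> {Suc L..n + s0}" "finite (large_primes L s i)"
    "real (card (large_primes L s i)) * ln 2 \<le> ln (real (n + s0))"
proof -
  have m: "int i - s > 0" "int i - s \<le> int (n + s0)" using assms by auto
  show sub: "large_primes L s i \<subseteq> {Suc L..n + s0}"
  proof
    fix p assume "p \<in> large_primes L s i"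
    hence "L < p" "int p dvd int i - s" by (auto simp: large_primes_def)
    hence "int p \<le> int i - s" using m by (intro zdvd_imp_le)
    thus "p \<in> {Suc L..n + s0}" using m \<open>L < p\<close> by auto
  qed
  show "finite (large_primes L s i)" using sub by (rule finite_subset) simp
  define m' where "m' = nat (int i - s)"
  have m': "m' > 0" "int i - s = int m'" "m' \<le> n + s0" using m by (auto simp: m'_def)
  have "card (large_primes L s i) \<le> card {p. prime p \<and> p dvd m'}"
  proof (rule card_mono)
    show "finite {p. prime p \<and> p dvd m'}"
      using finite_divisors_nat[OF m'(1)] by (rule rev_finite_subset) auto
    show "large_primes L s i \<subseteq> {p. prime p \<and> p dvd m'}"
      by (auto simp: large_primes_def m')
  qed
  hence "real (card (large_primes L s i)) * ln 2 \<le> real (card {p. prime p \<and> p dvd m'}) * ln 2"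
    by (intro mult_right_mono) auto
  also have "\<dots> \<le> ln (real m')" by (rule card_prime_divisors_le[OF m'(1)])
  also have "\<dots> \<le> ln (real (n + s0))" using m' by (intro ln_mono) auto
  finally show "real (card (large_primes L s i)) * ln 2 \<le> ln (real (n + s0))" .
qed

text \<open>After exchanging the sums, each \<open>p\<close> occurs for at most
  \<open>(n + s0) / p\<close> times \<open>i\<close>, which leaves a tail of the series of
  \<open>1 / p^2\<close>.\<close>

lemma sum_inverse_large_primes_le:
  assumes s: "\<bar>s\<bar> \<le> int s0" and L: "L \<ge> 1"
  shows "(\<Sum>i\<in>{s0<..n}. \<Sum>p\<in>large_primes L s i. 1 / real p) \<le> real (n + s0) / real L"
proof -
  have "(\<Sum>i\<in>{s0<..n}. \<Sum>p\<in>large_primes L s i. 1 / real p) \<le>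
    (\<Sum>i\<in>{s0<..n}. \<Sum>p\<in>{Suc L..n + s0}. of_bool (int p dvd int i - s) * (1 / real p))"
  proof (rule sum_mono)
    fix i assume "i \<in> {s0<..n}"
    hence i: "s0 < i" "i \<le> n" by auto
    have "(\<Sum>p\<in>large_primes L s i. 1 / real p) = (\<Sum>p\<in>large_primes L s i. of_bool (int p dvd int i - s) * (1 / real p))"
      by (intro sum.cong) (auto simp: large_primes_def)
    also have "\<dots> \<le> (\<Sum>p\<in>{Suc L..n + s0}. of_bool (int p dvd int i - s) * (1 / real p))"
      using large_primes_bound[OF s i] by (intro sum_mono2) auto
    finally show "(\<Sum>p\<in>large_primes L s i. 1 / real p) \<le> (\<Sum>p\<in>{Suc L..n + s0}. of_bool (int p dvd int i - s) * (1 / real p))" .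
  qed
  also have "\<dots> = (\<Sum>p\<in>{Suc L..n + s0}. (\<Sum>i\<in>{s0<..n}. of_bool (int p dvd int i - s)) * (1 / real p))"
    by (subst sum.swap) (simp only: sum_distrib_right)
  also have "\<dots> \<le> (\<Sum>p\<in>{Suc L..n + s0}. real (n + s0) / real p * (1 / real p))"
  proof (intro sum_mono mult_right_mono)
    fix p assume "p \<in> {Suc L..n + s0}"
    hence "p > 0" by simp
    have "(\<Sum>i\<in>{s0<..n}. of_bool (int p dvd int i - s)) = real (card {i \<in> {s0<..n}. int p dvd int i - s})"
      by (subst sum_of_bool_eq) (auto intro!: arg_cong[where f = card])
    also have "\<dots> \<le> real (n + s0) / real p" by (rule card_multiples_le[OF \<open>p > 0\<close> s])
    finally show "(\<Sum>i\<in>{s0<..n}. of_bool (int p dvd int i - s)) \<le> real (n + s0) / real p" .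
  qed auto
  also have "\<dots> = real (n + s0) * (\<Sum>p\<in>{Suc L..n + s0}. 1 / (real p)\<^sup>2)"
    by (simp add: sum_distrib_left power2_eq_square)
  also have "\<dots> \<le> real (n + s0) * (1 / real L)"
    by (intro mult_left_mono sum_inverse_square_le L) auto
  finally show ?thesis by simp
qed

section \<open>Frequencies along a Bernoulli walk\<close>

locale bernoulli_walk = prob_space M for M :: "'a measure" +
  fixes \<xi> :: "nat \<Rightarrow> 'a \<Rightarrow> bool" and \<alpha> :: real
  assumes alpha: "0 < \<alpha>" "\<alpha> < 1"
    and indep: "indep_vars (\<lambda>_. count_space UNIV) \<xi> UNIV"
    and step_prob: "\<And>i. prob {\<omega> \<in> space M. \<xi> i \<omega>} = \<alpha>"
begin

lemma fst_plus_snd_walk: "fst (walk \<xi> i \<omega>) + snd (walk \<xi> i \<omega>) = int i"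
  by (induction i) auto

lemma measurable_step [measurable]: "\<xi> i \<in> measurable M (count_space UNIV)"
  using indep by (auto simp: indep_vars_def)

lemma measurable_walk [measurable]: "walk \<xi> i \<in> measurable M (count_space UNIV)"
proof (induction i)
  case (Suc i)
  note [measurable] = Suc
  have "(\<lambda>\<omega>. walk \<xi> i \<omega> + (if \<xi> i \<omega> then (1, 0) else (0, 1))) \<in> measurable M (count_space UNIV)"
    by (rule measurable_compose_countable[where g = "walk \<xi> i"]) measurable
  thus ?case by simp
qed simp

lemma borel_measurable_of_walk [measurable]:
  "(\<lambda>\<omega>. f (walk \<xi> i \<omega>)) \<in> borel_measurable M" for f :: "_ \<Rightarrow> _ :: topological_space"
  by (rule measurable_compose[OF measurable_walk]) simp

lemma integrable_of_walk:
  fixes f :: "int \<times> int \<Rightarrow> _ :: {banach, second_countable_topology}"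
  assumes "\<And>z. norm (f z) \<le> B"
  shows "integrable M (\<lambda>\<omega>. f (walk \<xi> i \<omega>))"
  by (rule integrable_const_bound[of _ B]) (use assms in auto)

section \<open>Characters of the walk and their moments\<close>

definition step_char :: "real \<Rightarrow> real \<Rightarrow> nat \<Rightarrow> 'a \<Rightarrow> complex" where
  "step_char s t l \<omega> = cis (if \<xi> l \<omega> then s else t)"

definition walk_char :: "real \<Rightarrow> real \<Rightarrow> int \<times> int \<Rightarrow> complex" where
  "walk_char s t z = cis (s * real_of_int (fst z) + t * real_of_int (snd z))"

text \<open>The characteristic function of a single step at the frequencies \<open>s\<close> and
  \<open>t\<close>.\<close>

definition step_mean :: "real \<Rightarrow> real \<Rightarrow> complex" where
  "step_mean s t = \<alpha> * cis s + (1 - \<alpha>) * cis t"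

lemma norm_walk_char [simp]: "cmod (walk_char s t z) = 1"
  by (simp add: walk_char_def)

lemma walk_char_walk: "walk_char s t (walk \<xi> i \<omega>) = (\<Prod>l<i. step_char s t l \<omega>)"
proof (induction i)
  case (Suc i)
  have "walk_char s t (walk \<xi> (Suc i) \<omega>) = walk_char s t (walk \<xi> i \<omega>) * step_char s t i \<omega>"
    by (auto simp: walk_char_def step_char_def cis_mult algebra_simps)
  thus ?case using Suc by simp
qed (simp add: walk_char_def)

text \<open>The first \<open>i\<close> factors have modulus one and cancel against their conjugates,
  so only the steps from \<open>i\<close> to \<open>j - 1\<close> remain.\<close>

lemma walk_char_mult_cnj:
  assumes "i \<le> j"
  shows "walk_char s t (walk \<xi> j \<omega>) * cnj (walk_char s t (walk \<xi> i \<omega>)) = (\<Prod>l\<in>{i..<j}. step_char s t l \<omega>)"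
proof -
  have "{..<j} = {..<i} \<union> {i..<j}" using assms by auto
  hence "walk_char s t (walk \<xi> j \<omega>) = walk_char s t (walk \<xi> i \<omega>) * (\<Prod>l\<in>{i..<j}. step_char s t l \<omega>)"
    unfolding walk_char_walk by (metis finite_atLeastLessThan finite_lessThan ivl_disj_int_one(2) prod.union_disjoint)
  moreover have "walk_char s t (walk \<xi> i \<omega>) * cnj (walk_char s t (walk \<xi> i \<omega>)) = 1"
    by (simp add: complex_norm_square[symmetric])
  ultimately show ?thesis by (simp add: algebra_simps)
qed

lemma step_char_measurable [measurable]: "step_char s t l \<in> borel_measurable M"
  unfolding step_char_def by measurable

lemma expectation_step_char: "expectation (step_char s t l) = step_mean s t"
proof -
  have "expectation (step_char s t l) =
    expectation (\<lambda>\<omega>. cis t + indicator {\<omega> \<in> space M. \<xi> l \<omega>} \<omega> *\<^sub>R (cis s - cis t))"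
    by (intro Bochner_Integration.integral_cong) (auto simp: step_char_def)
  also have "\<dots> = cis t + \<alpha> *\<^sub>R (cis s - cis t)"
    by (subst Bochner_Integration.integral_add) (auto simp: prob_space step_prob[of l] less_top[symmetric])
  finally show ?thesis by (simp add: step_mean_def algebra_simps scaleR_conv_of_real)
qed

lemma expectation_prod_step_char:
  assumes "finite I"
  shows "expectation (\<lambda>\<omega>. \<Prod>l\<in>I. step_char s t l \<omega>) = step_mean s t ^ card I"
proof -
  have "indep_vars (\<lambda>_. borel) (\<lambda>l \<omega>. cis (if \<xi> l \<omega> then s else t)) I"
    by (rule indep_vars_compose2[OF indep_vars_subset[OF indep], where Y = "\<lambda>_ b. cis (if b then s else t)"]) auto
  hence "indep_vars (\<lambda>_. borel) (step_char s t) I"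
    by (simp add: step_char_def[abs_def])
  moreover have "integrable M (step_char s t l)" for l
    by (rule integrable_const_bound[of _ 1]) (auto simp: step_char_def)
  ultimately have "expectation (\<lambda>\<omega>. \<Prod>l\<in>I. step_char s t l \<omega>) = (\<Prod>l\<in>I. expectation (step_char s t l))"
    using assms by (intro indep_vars_lebesgue_integral)
  thus ?thesis by (simp add: expectation_step_char)
qed

lemma expectation_walk_char: "expectation (\<lambda>\<omega>. walk_char s t (walk \<xi> i \<omega>)) = step_mean s t ^ i"
  unfolding walk_char_walk by (subst expectation_prod_step_char) auto

lemma norm_step_mean_le: "cmod (step_mean s t) \<le> 1"
proof -
  have "cmod (step_mean s t) \<le> cmod (\<alpha> * cis s) + cmod ((1 - \<alpha>) * cis t)"
    unfolding step_mean_def by (rule norm_triangle_ineq)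
  also have "cmod ((1 - \<alpha>) * cis t) = 1 - \<alpha>"
    using alpha unfolding norm_mult norm_of_real by simp
  finally show ?thesis using alpha by (simp add: norm_mult)
qed

lemma integrable_walk_char_sum: "integrable M (\<lambda>\<omega>. (cmod (\<Sum>i = 1..n. walk_char s t (walk \<xi> i \<omega>))) ^ e)"
proof (rule integrable_const_bound[of _ "real n ^ e"])
  have "cmod (\<Sum>i = 1..n. walk_char s t (walk \<xi> i \<omega>)) \<le> real n" for \<omega>
    using norm_sum[of "\<lambda>i. walk_char s t (walk \<xi> i \<omega>)" "{1..n}"] by simp
  thus "AE \<omega> in M. norm (cmod (\<Sum>i = 1..n. walk_char s t (walk \<xi> i \<omega>)) ^ e) \<le> real n ^ e"
    by (intro AE_I2) (auto intro: power_mono)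
qed measurable

text \<open>Induction on \<open>n\<close>: a new term adds \<open>1\<close> and twice the real part
  of its correlations with the earlier terms. By independence these form a geometric sum in
  \<open>step_mean s t\<close>, of modulus at most \<open>2 / cmod (1 - step_mean s t)\<close>.
  Since the distance to \<open>1\<close> is at most \<open>2\<close>, the summand \<open>1\<close>
  costs another \<open>2\<close> over that distance, and \<open>2 + 4 = 6\<close>.\<close>

lemma second_moment_walk_char_sum:
  assumes z: "step_mean s t \<noteq> 1"
  shows "expectation (\<lambda>\<omega>. (cmod (\<Sum>i = 1..n. walk_char s t (walk \<xi> i \<omega>)))\<^sup>2)
    \<le> 6 * real n / cmod (1 - step_mean s t)"
proof (induction n)
  case (Suc n)
  let ?z = "step_mean s t" and ?c = "\<lambda>i \<omega>. walk_char s t (walk \<xi> i \<omega>)"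
  let ?S = "\<lambda>\<omega>. \<Sum>i = 1..n. ?c i \<omega>"
  have d: "cmod (1 - ?z) > 0" using z by simp
  have d2: "cmod (1 - ?z) \<le> 2" using norm_triangle_ineq4[of 1 ?z] norm_step_mean_le[of s t] by simp
  have sq: "(cmod (a + b))\<^sup>2 = (cmod a)\<^sup>2 + (cmod b)\<^sup>2 + 2 * Re (b * cnj a)" for a b
    unfolding cmod_power2 by (simp add: power2_eq_square algebra_simps)
  have eq: "(cmod (\<Sum>i = 1..Suc n. ?c i \<omega>))\<^sup>2 = (cmod (?S \<omega>))\<^sup>2 + 1
       + 2 * Re (\<Sum>i = 1..n. \<Prod>l\<in>{i..<Suc n}. step_char s t l \<omega>)" for \<omega>
  proof -
    have "?c (Suc n) \<omega> * cnj (?S \<omega>) = (\<Sum>i = 1..n. ?c (Suc n) \<omega> * cnj (?c i \<omega>))"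
      by (simp add: sum_distrib_left)
    also have "\<dots> = (\<Sum>i = 1..n. \<Prod>l\<in>{i..<Suc n}. step_char s t l \<omega>)"
      by (intro sum.cong walk_char_mult_cnj) auto
    finally show ?thesis using sq[of "?S \<omega>" "?c (Suc n) \<omega>"] by simp
  qed
  have int: "integrable M (\<lambda>\<omega>. \<Prod>l\<in>I. step_char s t l \<omega>)" for I
    by (rule integrable_const_bound[of _ 1]) (auto simp: step_char_def simp flip: prod_norm)
  define Q where "Q = (\<lambda>i \<omega>. \<Prod>l\<in>{i..<Suc n}. step_char s t l \<omega>)"
  have intQ: "integrable M (Q i)" for i unfolding Q_def by (rule int)
  have "expectation (\<lambda>\<omega>. (cmod (?S \<omega>))\<^sup>2 + 1 + 2 * Re (\<Sum>i = 1..n. Q i \<omega>)) =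
     expectation (\<lambda>\<omega>. (cmod (?S \<omega>))\<^sup>2) + 1 + 2 * Re (\<Sum>i = 1..n. expectation (Q i))"
    using intQ integrable_walk_char_sum[where n = n and e = 2] by (simp add: prob_space)
  hence "expectation (\<lambda>\<omega>. (cmod (\<Sum>i = 1..Suc n. ?c i \<omega>))\<^sup>2) = expectation (\<lambda>\<omega>. (cmod (?S \<omega>))\<^sup>2) + 1
     + 2 * Re (\<Sum>i = 1..n. expectation (\<lambda>\<omega>. \<Prod>l\<in>{i..<Suc n}. step_char s t l \<omega>))"
    unfolding eq Q_def .
  also have "(\<Sum>i = 1..n. expectation (\<lambda>\<omega>. \<Prod>l\<in>{i..<Suc n}. step_char s t l \<omega>)) = (\<Sum>i = 1..n. ?z ^ (Suc n - i))"
    by (intro sum.cong refl) (subst expectation_prod_step_char, auto)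
  also have "\<dots> = (\<Sum>i<n. ?z * ?z ^ i)"
    by (rule sum.reindex_bij_witness[of _ "\<lambda>i. n - i" "\<lambda>i. n - i"]) (auto simp: Suc_diff_le)
  also have "\<dots> = ?z * ((1 - ?z ^ n) / (1 - ?z))"
    unfolding sum_distrib_left[symmetric] using z by (simp add: sum_gp_strict)
  also have "Re \<dots> \<le> 2 / cmod (1 - ?z)"
  proof -
    have "cmod (1 - ?z ^ n) \<le> 1 + 1"
      using norm_triangle_ineq4[of 1 "?z ^ n"] power_le_one[OF _ norm_step_mean_le, of s t n]
      by (simp add: norm_power)
    hence "cmod ?z * cmod (1 - ?z ^ n) \<le> 1 * 2"
      using norm_step_mean_le by (intro mult_mono) auto
    hence "cmod (?z * ((1 - ?z ^ n) / (1 - ?z))) \<le> 2 / cmod (1 - ?z)"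
      using d by (simp add: norm_mult norm_divide divide_right_mono)
    thus ?thesis using complex_Re_le_cmod order_trans by blast
  qed
  finally have "expectation (\<lambda>\<omega>. (cmod (\<Sum>i = 1..Suc n. ?c i \<omega>))\<^sup>2)
     \<le> 6 * real n / cmod (1 - ?z) + 1 + 2 * (2 / cmod (1 - ?z))" using Suc by simp
  also have "1 \<le> 2 / cmod (1 - ?z)" using d d2 by simp
  finally show ?case by (simp add: add_divide_distrib algebra_simps)
qed simp

text \<open>The Cauchy-Schwarz inequality, read off from the variance being nonnegative.\<close>

lemma expectation_le_sqrt:
  fixes f :: "'a \<Rightarrow> real"
  assumes "integrable M f" "integrable M (\<lambda>x. (f x)\<^sup>2)"
  shows "expectation f \<le> sqrt (expectation (\<lambda>x. (f x)\<^sup>2))"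
  using variance_eq[OF assms] variance_positive[of f] by (intro real_le_rsqrt) linarith

section \<open>Equidistribution in residue classes, with rates\<close>

definition hits :: "nat \<Rightarrow> int \<times> int \<Rightarrow> nat \<Rightarrow> 'a \<Rightarrow> real" where
  "hits N w n \<omega> = (\<Sum>i = 1..n. of_bool (int N dvd fst (walk \<xi> i \<omega>) - fst w \<and> int N dvd snd (walk \<xi> i \<omega>) - snd w))"

lemma hits_measurable [measurable]: "hits N w n \<in> borel_measurable M"
  unfolding hits_def by measurable

lemma hits_bounds: "0 \<le> hits N w n \<omega>" "hits N w n \<omega> \<le> real n"
proof -
  show "0 \<le> hits N w n \<omega>" unfolding hits_def by (intro sum_nonneg) auto
  have "hits N w n \<omega> \<le> (\<Sum>i = 1..n. 1)" unfolding hits_def by (intro sum_mono) auto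
  thus "hits N w n \<omega> \<le> real n" by simp
qed

lemma integrable_hits: "integrable M (hits N w n)"
  by (rule integrable_const_bound[of _ "real n"]) (use hits_bounds in auto)

text \<open>Fourier expansion on pairs of residues modulo \<open>N\<close>: the double sum factors
  into two one-dimensional orthogonality relations.\<close>

lemma residue_indicator_eq_sum_char:
  assumes "N > 0"
  shows "complex_of_real (of_bool (int N dvd fst z - fst w \<and> int N dvd snd z - snd w)) =
    (1 / (of_nat N)\<^sup>2) * (\<Sum>(a, b)\<in>{..<N} \<times> {..<N}.
       cnj (walk_char (2 * pi * real a / real N) (2 * pi * real b / real N) w)
       * walk_char (2 * pi * real a / real N) (2 * pi * real b / real N) z)"
proof -
  let ?f = "\<lambda>u k. cis (2 * pi * real k * real_of_int u / real N)"
  have "(\<Sum>(a, b)\<in>{..<N} \<times> {..<N}.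
       cnj (walk_char (2 * pi * real a / real N) (2 * pi * real b / real N) w)
       * walk_char (2 * pi * real a / real N) (2 * pi * real b / real N) z) =
    (\<Sum>(a, b)\<in>{..<N} \<times> {..<N}. ?f (fst z - fst w) a * ?f (snd z - snd w) b)"
    by (intro sum.cong refl)
       (auto simp: walk_char_def cis_cnj cis_mult diff_divide_distrib add_divide_distrib algebra_simps)
  also have "\<dots> = (\<Sum>a<N. ?f (fst z - fst w) a) * (\<Sum>b<N. ?f (snd z - snd w) b)"
    by (simp add: sum_product sum.cartesian_product)
  also have "\<dots> = of_bool (int N dvd fst z - fst w \<and> int N dvd snd z - snd w) * (of_nat N)\<^sup>2"
    unfolding sum_cis_eq_indicator[OF assms] by (simp add: power2_eq_square)
  finally show ?thesis using assms by simp
qed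

text \<open>The second moment constant \<open>6\<close> divided by the constant
  \<open>8 * min \<alpha> (1 - \<alpha>)\<close> of the spectral gap, under a square root because
  first moments are estimated.\<close>

definition mixing_const :: real where
  "mixing_const = sqrt (6 / (8 * min \<alpha> (1 - \<alpha>)))"

lemma mixing_const_nonneg: "mixing_const \<ge> 0"
  using alpha by (simp add: mixing_const_def)

text \<open>The trivial character contributes exactly \<open>1 / N^2\<close>. Each of the fewer than
  \<open>N^2\<close> others has a sum of mean modulus at most
  \<open>mixing_const * N * sqrt n\<close>, and the expansion carries the factor
  \<open>1 / (N^2 * n)\<close>.\<close>

lemma expectation_hits_deviation:
  assumes N: "N > 0" and n: "n > 0"
  shows "expectation (\<lambda>\<omega>. \<bar>hits N w n \<omega> / real n - 1 / (real N)\<^sup>2\<bar>) \<le> mixing_const * real N / sqrt (real n)"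
proof -
  define \<mu> where "\<mu> = min \<alpha> (1 - \<alpha>)"
  have \<mu>: "\<mu> > 0" using alpha by (simp add: \<mu>_def)
  define ch where "ch = (\<lambda>a b. walk_char (2 * pi * real a / real N) (2 * pi * real b / real N))"
  define S where "S = (\<lambda>(a, b) \<omega>. cmod (\<Sum>i = 1..n. ch a b (walk \<xi> i \<omega>)))"
  define R where "R = {..<N} \<times> {..<N} - {(0, 0)}"
  have R: "finite R" "insert (0, 0) R = {..<N} \<times> {..<N}" "(0, 0) \<notin> R" using N by (auto simp: R_def)
  have cardR: "real (card R) \<le> (real N)\<^sup>2"
    using card_mono[of "{..<N} \<times> {..<N}" R] by (simp add: R_def card_cartesian_product power2_eq_square flip: of_nat_mult)
  have intS: "integrable M (\<lambda>\<omega>. S ab \<omega> ^ e)" for ab e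
    using integrable_walk_char_sum by (simp add: S_def ch_def split: prod.split)
  have ES: "expectation (S ab) \<le> mixing_const * real N * sqrt (real n)" if "ab \<in> R" for ab
  proof -
    obtain a b where ab: "ab = (a, b)" by force
    let ?z = "step_mean (2 * pi * real a / real N) (2 * pi * real b / real N)"
    have ge: "cmod (1 - ?z) \<ge> \<mu> * 8 / (real N)\<^sup>2"
      unfolding step_mean_def \<mu>_def using that ab alpha by (intro cmod_one_minus_char_ge) (auto simp: R_def)
    moreover have pos: "\<mu> * 8 / (real N)\<^sup>2 > 0" using \<mu> N by simp
    ultimately have "?z \<noteq> 1" by auto
    hence "expectation (\<lambda>\<omega>. (S ab \<omega>)\<^sup>2) \<le> 6 * real n / cmod (1 - ?z)"
      using second_moment_walk_char_sum unfolding ab S_def ch_def by simp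
    also have "\<dots> \<le> 6 * real n / (\<mu> * 8 / (real N)\<^sup>2)"
      using ge pos by (intro divide_left_mono mult_pos_pos) linarith+
    also have "\<dots> = 6 / (8 * \<mu>) * ((real N)\<^sup>2 * real n)" by simp
    finally have "sqrt (expectation (\<lambda>\<omega>. (S ab \<omega>)\<^sup>2)) \<le> sqrt (6 / (8 * \<mu>) * ((real N)\<^sup>2 * real n))" by simp
    also have "\<dots> = mixing_const * real N * sqrt (real n)"
      unfolding real_sqrt_mult mixing_const_def \<mu>_def[symmetric] by simp
    finally show ?thesis
      using expectation_le_sqrt[of "S ab"] intS[of ab 1] intS[of ab 2] by simp
  qed
  have bound: "\<bar>hits N w n \<omega> / real n - 1 / (real N)\<^sup>2\<bar> \<le> 1 / ((real N)\<^sup>2 * real n) * (\<Sum>ab\<in>R. S ab \<omega>)" for \<omega>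
  proof -
    have "complex_of_real (hits N w n \<omega>) =
      (\<Sum>i = 1..n. (1 / (of_nat N)\<^sup>2) * (\<Sum>(a, b)\<in>{..<N} \<times> {..<N}. cnj (ch a b w) * ch a b (walk \<xi> i \<omega>)))"
      unfolding hits_def of_real_sum ch_def by (intro sum.cong refl residue_indicator_eq_sum_char N)
    also have "\<dots> = (1 / (of_nat N)\<^sup>2) * (\<Sum>(a, b)\<in>{..<N} \<times> {..<N}. cnj (ch a b w) * (\<Sum>i = 1..n. ch a b (walk \<xi> i \<omega>)))"
      by (subst sum_distrib_left[symmetric], subst sum.swap) (simp add: sum_distrib_left case_prod_beta)
    also have "\<dots> = (1 / (of_nat N)\<^sup>2) * (of_nat n +
       (\<Sum>(a, b)\<in>R. cnj (ch a b w) * (\<Sum>i = 1..n. ch a b (walk \<xi> i \<omega>))))"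
      unfolding R(2)[symmetric] sum.insert[OF R(1,3)] by (simp add: ch_def walk_char_def)
    finally have eq: "complex_of_real (hits N w n \<omega> / real n - 1 / (real N)\<^sup>2) =
       (1 / ((of_nat N)\<^sup>2 * of_nat n)) * (\<Sum>(a, b)\<in>R. cnj (ch a b w) * (\<Sum>i = 1..n. ch a b (walk \<xi> i \<omega>)))"
      using n N by (simp add: field_simps)
    have "\<bar>hits N w n \<omega> / real n - 1 / (real N)\<^sup>2\<bar> =
         cmod (complex_of_real (hits N w n \<omega> / real n - 1 / (real N)\<^sup>2))" by (simp only: norm_of_real)
    also have "\<dots> =
       1 / ((real N)\<^sup>2 * real n) * cmod (\<Sum>(a, b)\<in>R. cnj (ch a b w) * (\<Sum>i = 1..n. ch a b (walk \<xi> i \<omega>)))"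
      unfolding eq by (simp add: norm_mult norm_divide norm_power)
    also have "\<dots> \<le> 1 / ((real N)\<^sup>2 * real n) * (\<Sum>ab\<in>R. S ab \<omega>)"
    proof (intro mult_left_mono order_trans[OF norm_sum] sum_mono)
      fix ab show "cmod (case ab of (a, b) \<Rightarrow> cnj (ch a b w) * (\<Sum>i = 1..n. ch a b (walk \<xi> i \<omega>))) \<le> S ab \<omega>"
        by (cases ab) (simp add: S_def norm_mult ch_def)
    qed auto
    finally show ?thesis .
  qed
  have "expectation (\<lambda>\<omega>. \<bar>hits N w n \<omega> / real n - 1 / (real N)\<^sup>2\<bar>) \<le>
    expectation (\<lambda>\<omega>. 1 / ((real N)\<^sup>2 * real n) * (\<Sum>ab\<in>R. S ab \<omega>))"
  proof (rule integral_mono')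
    show "integrable M (\<lambda>\<omega>. 1 / ((real N)\<^sup>2 * real n) * (\<Sum>ab\<in>R. S ab \<omega>))"
      using intS[of _ 1] by simp
    show "0 \<le> 1 / ((real N)\<^sup>2 * real n) * (\<Sum>ab\<in>R. S ab \<omega>)" for \<omega>
      using order_trans[OF abs_ge_zero bound] .
  qed (rule bound)
  also have "\<dots> = 1 / ((real N)\<^sup>2 * real n) * (\<Sum>ab\<in>R. expectation (S ab))"
    using intS[of _ 1] by simp
  also have "\<dots> \<le> 1 / ((real N)\<^sup>2 * real n) * (\<Sum>ab\<in>R. mixing_const * real N * sqrt (real n))"
    using ES by (intro mult_left_mono sum_mono) auto
  also have "\<dots> \<le> 1 / ((real N)\<^sup>2 * real n) * ((real N)\<^sup>2 * (mixing_const * real N * sqrt (real n)))"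
    unfolding sum_constant using cardR \<mu>
    by (intro mult_left_mono mult_right_mono) (auto simp: mixing_const_def \<mu>_def)
  also have "\<dots> = mixing_const * real N * (sqrt (real n) / real n)" using N by simp
  also have "sqrt (real n) / real n = 1 / sqrt (real n)" using n by (simp add: real_div_sqrt field_simps)
  finally show ?thesis by simp
qed

text \<open>The \<open>2\<close> comes from \<open>sum_inverse_le_ln\<close>, the root from
  \<open>cmod_bernoulli_char_power_le\<close>.\<close>

definition local_const :: real where
  "local_const = 2 / sqrt (8 * \<alpha> * (1 - \<alpha>))"

lemma local_const_pos: "local_const > 0" using alpha by (simp add: local_const_def)

text \<open>A pointwise bound at time \<open>i\<close>, without averaging over time. Only characters
  of the first coordinate enter: frequency zero gives \<open>1 / m\<close>, and the others are
  summed with \<open>cmod_bernoulli_char_power_le\<close>.\<close>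

lemma expectation_residue_le:
  assumes m: "m > 0" and i: "i > 0"
  shows "expectation (\<lambda>\<omega>. of_bool (int m dvd fst (walk \<xi> i \<omega>) - r)) \<le>
    1 / real m + local_const * (1 + ln (real m)) / sqrt (real i)"
proof -
  define th where "th = (\<lambda>k. 2 * pi * real k / real m)"
  have ind: "complex_of_real (of_bool (int m dvd fst z - r)) =
     (1 / of_nat m) * (\<Sum>k<m. cis (- (th k * real_of_int r)) * walk_char (th k) 0 z)" for z :: "int \<times> int"
  proof -
    have "(\<Sum>k<m. cis (- (th k * real_of_int r)) * walk_char (th k) 0 z) =
      (\<Sum>k<m. cis (2 * pi * real k * real_of_int (fst z - r) / real m))"
      by (intro sum.cong refl)
         (auto simp: walk_char_def cis_mult th_def diff_divide_distrib algebra_simps)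
    also have "\<dots> = of_bool (int m dvd fst z - r) * of_nat m" unfolding sum_cis_eq_indicator[OF m] by simp
    finally show ?thesis using m by simp
  qed
  have int: "integrable M (\<lambda>\<omega>. walk_char s t (walk \<xi> i \<omega>))" for s t
    by (rule integrable_of_walk[of _ 1]) simp
  have "complex_of_real (expectation (\<lambda>\<omega>. of_bool (int m dvd fst (walk \<xi> i \<omega>) - r))) =
     expectation (\<lambda>\<omega>. complex_of_real (of_bool (int m dvd fst (walk \<xi> i \<omega>) - r)))"
    by (rule integral_complex_of_real[symmetric])
  also have "\<dots> = (1 / of_nat m) * (\<Sum>k<m. cis (- (th k * real_of_int r)) * step_mean (th k) 0 ^ i)"
    unfolding ind using int by (simp add: expectation_walk_char)
  finally have eq: "complex_of_real (expectation (\<lambda>\<omega>. of_bool (int m dvd fst (walk \<xi> i \<omega>) - r))) =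
     (1 / of_nat m) * (\<Sum>k<m. cis (- (th k * real_of_int r)) * step_mean (th k) 0 ^ i)" .
  have "expectation (\<lambda>\<omega>. of_bool (int m dvd fst (walk \<xi> i \<omega>) - r)) \<le>
     cmod (complex_of_real (expectation (\<lambda>\<omega>. of_bool (int m dvd fst (walk \<xi> i \<omega>) - r))))" by simp
  also have "\<dots> \<le> (1 / real m) * (\<Sum>k<m. cmod (step_mean (th k) 0) ^ i)"
    unfolding eq by (auto simp: norm_mult norm_divide norm_power intro!: divide_right_mono order_trans[OF norm_sum] sum_mono)
  also have "{..<m} = insert 0 {1..<m}" using m by auto
  also have "(\<Sum>k\<in>insert 0 {1..<m}. cmod (step_mean (th k) 0) ^ i) = cmod (step_mean (th 0) 0) ^ i + (\<Sum>k = 1..<m. cmod (step_mean (th k) 0) ^ i)"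
    by simp
  also have "cmod (step_mean (th 0) 0) = 1" by (simp add: step_mean_def th_def)
  also have "(\<Sum>k = 1..<m. cmod (step_mean (th k) 0) ^ i) \<le>
     (\<Sum>k = 1..<m. real m * (1 / real k + 1 / real (m - k)) / sqrt (8 * \<alpha> * (1 - \<alpha>) * real i))"
  proof (rule sum_mono)
    fix k assume "k \<in> {1..<m}"
    thus "cmod (step_mean (th k) 0) ^ i \<le> real m * (1 / real k + 1 / real (m - k)) / sqrt (8 * \<alpha> * (1 - \<alpha>) * real i)"
      using cmod_bernoulli_char_power_le[of k m i \<alpha>] i alpha by (simp add: step_mean_def th_def)
  qed
  also have "\<dots> = real m / sqrt (8 * \<alpha> * (1 - \<alpha>) * real i) * (\<Sum>k = 1..<m. 1 / real k + 1 / real (m - k))"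
    by (simp add: sum_distrib_left sum_divide_distrib)
  also have "\<dots> \<le> real m / sqrt (8 * \<alpha> * (1 - \<alpha>) * real i) * (2 * (1 + ln (real m)))"
    using alpha by (intro mult_left_mono sum_inverse_le_ln[OF m]) auto
  also have "(1 / real m) * (1 ^ i + real m / sqrt (8 * \<alpha> * (1 - \<alpha>) * real i) * (2 * (1 + ln (real m)))) =
     1 / real m + local_const * (1 + ln (real m)) / sqrt (real i)"
    using m unfolding local_const_def real_sqrt_mult[of _ "real i"] by (simp add: field_simps)
  finally show ?thesis using m by (simp add: divide_right_mono mult_left_mono)
qed

section \<open>Almost sure limits along twelfth powers\<close>

lemma AE_hits_frequency:
  assumes "N > 0"
  shows "AE \<omega> in M. (\<lambda>k. hits N w (Suc k ^ 12) \<omega> / real (Suc k ^ 12)) \<longlonglongrightarrow> 1 / (real N)\<^sup>2"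
proof -
  have "AE \<omega> in M. (\<lambda>k. \<bar>hits N w (Suc k ^ 12) \<omega> / real (Suc k ^ 12) - 1 / (real N)\<^sup>2\<bar>) \<longlonglongrightarrow> 0"
  proof (rule AE_tendsto_zero)
    fix k
    define K where "K = real (Suc k)"
    have K: "K \<ge> 1" by (simp add: K_def)
    show "integrable M (\<lambda>\<omega>. \<bar>hits N w (Suc k ^ 12) \<omega> / real (Suc k ^ 12) - 1 / (real N)\<^sup>2\<bar>)"
      using integrable_hits by simp
    have "expectation (\<lambda>\<omega>. \<bar>hits N w (Suc k ^ 12) \<omega> / real (Suc k ^ 12) - 1 / (real N)\<^sup>2\<bar>)
       \<le> mixing_const * real N / sqrt (real (Suc k ^ 12))"
      using assms by (intro expectation_hits_deviation) auto
    also have "sqrt (real (Suc k ^ 12)) = K ^ 6" unfolding K_def by (rule sqrt_twelfth_power)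
    also have "mixing_const * real N / K ^ 6 \<le> mixing_const * real N / K\<^sup>2"
      using K mixing_const_nonneg by (intro divide_left_mono power_increasing) auto
    finally show "expectation (\<lambda>\<omega>. \<bar>hits N w (Suc k ^ 12) \<omega> / real (Suc k ^ 12) - 1 / (real N)\<^sup>2\<bar>)
       \<le> mixing_const * real N / (real (Suc k))\<^sup>2" by (simp add: K_def)
  qed auto
  thus ?thesis
  proof eventually_elim
    case (elim \<omega>)
    hence "(\<lambda>k. hits N w (Suc k ^ 12) \<omega> / real (Suc k ^ 12) - 1 / (real N)\<^sup>2) \<longlonglongrightarrow> 0"
      by (rule tendsto_rabs_zero_cancel)
    thus ?case by (rule LIM_zero_cancel)
  qed
qed

text \<open>The exponent \<open>12\<close> is adapted to this sum: there are \<open>K^2\<close>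
  moduli, each at most \<open>K^2\<close>, with mean deviation at most
  \<open>mixing_const * K^2 / K^6\<close>. The total is of order \<open>1 / K^2\<close>, which is
  summable.\<close>

lemma AE_hits_small_moduli:
  "AE \<omega> in M. (\<lambda>k. \<Sum>p = 1..Suc k ^ 2. \<bar>hits p w (Suc k ^ 12) \<omega> / real (Suc k ^ 12) - 1 / (real p)\<^sup>2\<bar>) \<longlonglongrightarrow> 0"
proof (rule AE_tendsto_zero)
  fix k
  define K where "K = real (Suc k)"
  have K: "K \<ge> 1" by (simp add: K_def)
  have int: "integrable M (\<lambda>\<omega>. \<bar>hits p w (Suc k ^ 12) \<omega> / real (Suc k ^ 12) - 1 / (real p)\<^sup>2\<bar>)" for p
    using integrable_hits by simp
  thus "integrable M (\<lambda>\<omega>. \<Sum>p = 1..Suc k ^ 2. \<bar>hits p w (Suc k ^ 12) \<omega> / real (Suc k ^ 12) - 1 / (real p)\<^sup>2\<bar>)"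
    by (intro Bochner_Integration.integrable_sum)
  have "expectation (\<lambda>\<omega>. \<Sum>p = 1..Suc k ^ 2. \<bar>hits p w (Suc k ^ 12) \<omega> / real (Suc k ^ 12) - 1 / (real p)\<^sup>2\<bar>)
     = (\<Sum>p = 1..Suc k ^ 2. expectation (\<lambda>\<omega>. \<bar>hits p w (Suc k ^ 12) \<omega> / real (Suc k ^ 12) - 1 / (real p)\<^sup>2\<bar>))"
    by (rule Bochner_Integration.integral_sum[OF int])
  also have "\<dots> \<le> (\<Sum>p = 1..Suc k ^ 2. mixing_const * K ^ 2 / K ^ 6)"
  proof (rule sum_mono)
    fix p assume p: "p \<in> {1..Suc k ^ 2}"
    hence "expectation (\<lambda>\<omega>. \<bar>hits p w (Suc k ^ 12) \<omega> / real (Suc k ^ 12) - 1 / (real p)\<^sup>2\<bar>)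
        \<le> mixing_const * real p / sqrt (real (Suc k ^ 12))"
      by (intro expectation_hits_deviation) auto
    also have "sqrt (real (Suc k ^ 12)) = K ^ 6" unfolding K_def by (rule sqrt_twelfth_power)
    also have "mixing_const * real p / K ^ 6 \<le> mixing_const * K ^ 2 / K ^ 6"
    proof -
      have "real p \<le> real (Suc k ^ 2)" using p by (simp only: of_nat_le_iff) simp
      thus ?thesis using K mixing_const_nonneg
        by (intro divide_right_mono mult_left_mono) (auto simp: K_def)
    qed
    finally show "expectation (\<lambda>\<omega>. \<bar>hits p w (Suc k ^ 12) \<omega> / real (Suc k ^ 12) - 1 / (real p)\<^sup>2\<bar>)
        \<le> mixing_const * K ^ 2 / K ^ 6" .
  qed
  also have "\<dots> = K\<^sup>2 * (mixing_const * K ^ 2 / K ^ 6)" by (simp add: K_def)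
  also have "\<dots> = mixing_const / K\<^sup>2" using K by (simp add: field_simps flip: power_add)
  finally show "expectation (\<lambda>\<omega>. \<Sum>p = 1..Suc k ^ 2. \<bar>hits p w (Suc k ^ 12) \<omega> / real (Suc k ^ 12) - 1 / (real p)\<^sup>2\<bar>)
     \<le> mixing_const / (real (Suc k))\<^sup>2" by (simp add: K_def)
qed (auto intro: sum_nonneg)

text \<open>Points in the column or row of some \<open>w\<close> need separate treatment, since the
  prime criterion requires both differences to be nonzero. Letting \<open>c\<close> depend on
  \<open>i\<close> covers rows too: second coordinate \<open>v\<close> means first coordinate
  \<open>i - v\<close>.\<close>

lemma AE_line_frequency:
  "AE \<omega> in M. (\<lambda>k. (\<Sum>i = 1..Suc k ^ 12. of_bool (fst (walk \<xi> i \<omega>) = c i)) / real (Suc k ^ 12)) \<longlonglongrightarrow> 0"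
proof (rule AE_tendsto_zero)
  fix k
  define K where "K = real (Suc k)"
  define n where "n = Suc k ^ 12"
  have K: "K \<ge> 1" by (simp add: K_def)
  have n: "n > 0" "sqrt (real n) = K ^ 6" "real n = K ^ 12"
    unfolding n_def K_def by (simp, rule sqrt_twelfth_power, simp)
  have int: "integrable M (\<lambda>\<omega>. of_bool (fst (walk \<xi> i \<omega>) = c i) :: real)" for i
    by (rule integrable_of_walk[of "\<lambda>z. of_bool (fst z = c i)" 1]) auto
  thus "integrable M (\<lambda>\<omega>. (\<Sum>i = 1..Suc k ^ 12. of_bool (fst (walk \<xi> i \<omega>) = c i)) / real (Suc k ^ 12) :: real)"
    by (intro Bochner_Integration.integrable_sum integrable_divide)
  have E: "expectation (\<lambda>\<omega>. of_bool (fst (walk \<xi> i \<omega>) = c i)) \<le> 1 / K\<^sup>2 + local_const * (1 + 2 * K) * (1 / sqrt (real i))"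
    if "i \<in> {1..n}" for i
  proof -
    \<comment> \<open>Equality is relaxed to a congruence modulo \<open>K^2\<close>, a modulus large
      enough for the main term \<open>1 / K^2\<close> to be summable.\<close>
    have "expectation (\<lambda>\<omega>. of_bool (fst (walk \<xi> i \<omega>) = c i) :: real) \<le>
      expectation (\<lambda>\<omega>. of_bool (int (Suc k ^ 2) dvd fst (walk \<xi> i \<omega>) - c i))"
      by (intro integral_mono int integrable_of_walk[of "\<lambda>z. of_bool (int (Suc k ^ 2) dvd fst z - c i)" 1]) auto
    also have "\<dots> \<le> 1 / real (Suc k ^ 2) + local_const * (1 + ln (real (Suc k ^ 2))) / sqrt (real i)"
      using that by (intro expectation_residue_le) auto
    also have "\<dots> \<le> 1 / K\<^sup>2 + local_const * (1 + 2 * K) / sqrt (real i)"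
    proof -
      have "ln K \<le> K" using K ln_le_minus_one[of K] by simp
      hence "ln (real (Suc k ^ 2)) \<le> 2 * K" unfolding of_nat_power K_def[symmetric] using K by (simp add: ln_realpow)
      thus ?thesis using local_const_pos
        by (intro add_mono divide_right_mono mult_left_mono) (auto simp: K_def)
    qed
    finally show ?thesis by simp
  qed
  have "expectation (\<lambda>\<omega>. (\<Sum>i = 1..n. of_bool (fst (walk \<xi> i \<omega>) = c i)) / real n) =
    (\<Sum>i = 1..n. expectation (\<lambda>\<omega>. of_bool (fst (walk \<xi> i \<omega>) = c i))) / real n"
    using int by (simp del: sum_of_bool_eq)
  also have "\<dots> \<le> (\<Sum>i = 1..n. 1 / K\<^sup>2 + local_const * (1 + 2 * K) * (1 / sqrt (real i))) / real n"
    by (intro divide_right_mono sum_mono E) auto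
  also have "(\<Sum>i = 1..n. 1 / K\<^sup>2 + local_const * (1 + 2 * K) * (1 / sqrt (real i))) =
     real n / K\<^sup>2 + local_const * (1 + 2 * K) * (\<Sum>i = 1..n. 1 / sqrt (real i))"
    by (simp add: sum.distrib sum_distrib_left)
  also have "\<dots> \<le> real n / K\<^sup>2 + local_const * (3 * K) * (2 * sqrt (real n))"
    using sum_inverse_sqrt_le[of n] local_const_pos K by (intro add_left_mono mult_mono mult_nonneg_nonneg sum_nonneg) auto
  also have "(real n / K\<^sup>2 + local_const * (3 * K) * (2 * sqrt (real n))) / real n = 1 / K\<^sup>2 + 6 * local_const * (1 / K ^ 5)"
    unfolding n(2) unfolding n(3) using K by (simp add: field_simps flip: power_add power_Suc2 power_Suc)
  also have "\<dots> \<le> 1 / K\<^sup>2 + 6 * local_const * (1 / K ^ 2)"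
    using K local_const_pos by (intro add_left_mono mult_left_mono divide_left_mono power_increasing) auto
  finally show "expectation (\<lambda>\<omega>. (\<Sum>i = 1..Suc k ^ 12. of_bool (fst (walk \<xi> i \<omega>) = c i)) / real (Suc k ^ 12)) \<le>
     (1 + 6 * local_const) / (real (Suc k))\<^sup>2"
    using n(1) by (simp add: n_def K_def add_divide_distrib divide_right_mono)
qed (auto intro: sum_nonneg)

text \<open>A first moment estimate. The main terms \<open>1 / p\<close> add up to at most
  \<open>(n + s0) / K^2\<close>. For the errors, at each time there are logarithmically many primes
  with a logarithmic factor each, and the sum of \<open>1 / sqrt i\<close> is of order
  \<open>K^6\<close>, far below \<open>n = K^12\<close>.\<close>

lemma AE_large_primes_frequency:
  assumes s: "\<bar>s\<bar> \<le> int s0"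
  shows "AE \<omega> in M. (\<lambda>k. (\<Sum>i\<in>{s0<..Suc k ^ 12}. \<Sum>p\<in>large_primes (Suc k ^ 2) s i.
     of_bool (int p dvd fst (walk \<xi> i \<omega>) - u)) / real (Suc k ^ 12)) \<longlonglongrightarrow> 0"
proof (rule AE_tendsto_zero)
  fix k
  define K where "K = real (Suc k)"
  define n where "n = Suc k ^ 12"
  define L where "L = Suc k ^ 2"
  define \<Lambda> where "\<Lambda> = ln (real (n + s0))"
  have K: "K \<ge> 1" by (simp add: K_def)
  have n: "n > 0" "sqrt (real n) = K ^ 6" "real n = K ^ 12"
    unfolding n_def K_def by (simp, rule sqrt_twelfth_power, simp)
  have L: "L \<ge> 1" "real L = K\<^sup>2" by (auto simp: L_def K_def)
  have int: "integrable M (\<lambda>\<omega>. of_bool (int p dvd fst (walk \<xi> i \<omega>) - u) :: real)" for p i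
    by (rule integrable_of_walk[of "\<lambda>z. of_bool (int p dvd fst z - u)" 1]) auto
  thus "integrable M (\<lambda>\<omega>. (\<Sum>i\<in>{s0<..Suc k ^ 12}. \<Sum>p\<in>large_primes (Suc k ^ 2) s i.
     of_bool (int p dvd fst (walk \<xi> i \<omega>) - u)) / real (Suc k ^ 12) :: real)"
    by (intro Bochner_Integration.integrable_sum integrable_divide)
  \<comment> \<open>Logarithms are replaced by linear bounds in \<open>K\<close>; the spare powers
    of \<open>K\<close> absorb the loss.\<close>
  have \<Lambda>: "0 \<le> \<Lambda>" "\<Lambda> \<le> (12 + real s0) * K"
  proof -
    show "0 \<le> \<Lambda>" using n by (simp add: \<Lambda>_def)
    have "real (n + s0) \<le> K ^ 12 * (1 + real s0)"
      using K mult_right_mono[of 1 "K ^ 12" "real s0"] by (simp add: n algebra_simps)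
    hence "\<Lambda> \<le> ln (K ^ 12 * (1 + real s0))" unfolding \<Lambda>_def using n by (intro ln_mono) auto
    also have "\<dots> = 12 * ln K + ln (1 + real s0)" using K by (subst ln_mult) (auto simp: ln_realpow)
    also have "\<dots> \<le> 12 * K + real s0 * K"
    proof -
      have "ln K \<le> K" using K ln_le_minus_one[of K] by simp
      moreover have "ln (1 + real s0) \<le> real s0" by (rule ln_add_one_self_le_self) simp
      moreover have "real s0 * 1 \<le> real s0 * K" using K by (intro mult_left_mono) auto
      ultimately show ?thesis by linarith
    qed
    finally show "\<Lambda> \<le> (12 + real s0) * K" by (simp add: algebra_simps)
  qed
  have E: "expectation (\<lambda>\<omega>. of_bool (int p dvd fst (walk \<xi> i \<omega>) - u)) \<le> 1 / real p + local_const * (1 + \<Lambda>) * (1 / sqrt (real i))"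
    if "i \<in> {s0<..n}" "p \<in> large_primes L s i" for i p
  proof -
    have p: "p \<in> {Suc L..n + s0}" using large_primes_bound(1)[OF s, of i n L] that by auto
    have "expectation (\<lambda>\<omega>. of_bool (int p dvd fst (walk \<xi> i \<omega>) - u)) \<le> 1 / real p + local_const * (1 + ln (real p)) / sqrt (real i)"
      using that p by (intro expectation_residue_le) auto
    also have "\<dots> \<le> 1 / real p + local_const * (1 + \<Lambda>) / sqrt (real i)"
      using local_const_pos p unfolding \<Lambda>_def
      by (intro add_left_mono divide_right_mono mult_left_mono ln_mono) auto
    finally show ?thesis by simp
  qed
  \<comment> \<open>The number of primes is at most \<open>\<Lambda> / ln 2\<close>, and
    \<open>1 + \<Lambda>\<close> is at most \<open>(13 + s0) * K\<close>.\<close>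
  define C where "C = (12 + real s0) * (13 + real s0) / ln 2"
  have C: "C \<ge> 0" by (simp add: C_def)
  have card: "real (card (large_primes L s i)) * (1 + \<Lambda>) \<le> C * K\<^sup>2" if "i \<in> {s0<..n}" for i
  proof -
    have "real (card (large_primes L s i)) * ln 2 \<le> \<Lambda>"
      using large_primes_bound(3)[OF s, of i n L] that by (simp add: \<Lambda>_def)
    hence "real (card (large_primes L s i)) \<le> \<Lambda> / ln 2" by (simp add: field_simps)
    hence "real (card (large_primes L s i)) * (1 + \<Lambda>) \<le> (12 + real s0) * K / ln 2 * (K + (12 + real s0) * K)"
      using \<Lambda> K by (intro mult_mono add_mono order_trans[OF _ divide_right_mono[OF \<Lambda>(2)]]) auto
    also have "\<dots> = C * K\<^sup>2" by (simp add: C_def power2_eq_square algebra_simps add_divide_distrib)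
    finally show ?thesis .
  qed
  have "expectation (\<lambda>\<omega>. (\<Sum>i\<in>{s0<..n}. \<Sum>p\<in>large_primes L s i. of_bool (int p dvd fst (walk \<xi> i \<omega>) - u)) / real n)
     = (\<Sum>i\<in>{s0<..n}. \<Sum>p\<in>large_primes L s i. expectation (\<lambda>\<omega>. of_bool (int p dvd fst (walk \<xi> i \<omega>) - u))) / real n"
    using int by (simp del: sum_of_bool_eq)
  also have "\<dots> \<le> (\<Sum>i\<in>{s0<..n}. \<Sum>p\<in>large_primes L s i. 1 / real p + local_const * (1 + \<Lambda>) * (1 / sqrt (real i))) / real n"
    by (intro divide_right_mono sum_mono E) auto
  also have "\<dots> = ((\<Sum>i\<in>{s0<..n}. \<Sum>p\<in>large_primes L s i. 1 / real p)
      + (\<Sum>i\<in>{s0<..n}. local_const * (real (card (large_primes L s i)) * (1 + \<Lambda>)) * (1 / sqrt (real i)))) / real n"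
    by (simp add: sum.distrib mult_ac)
  also have "\<dots> \<le> (real (n + s0) / real L + local_const * (C * K\<^sup>2) * (2 * sqrt (real n))) / real n"
  proof (intro divide_right_mono add_mono sum_inverse_large_primes_le s L)
    have "(\<Sum>i\<in>{s0<..n}. local_const * (real (card (large_primes L s i)) * (1 + \<Lambda>)) * (1 / sqrt (real i))) \<le>
       (\<Sum>i\<in>{s0<..n}. local_const * (C * K\<^sup>2) * (1 / sqrt (real i)))"
      using local_const_pos by (intro sum_mono mult_right_mono mult_left_mono card) auto
    also have "\<dots> \<le> (\<Sum>i = 1..n. local_const * (C * K\<^sup>2) * (1 / sqrt (real i)))"
      using local_const_pos C K by (intro sum_mono2) auto
    also have "\<dots> = local_const * (C * K\<^sup>2) * (\<Sum>i = 1..n. 1 / sqrt (real i))" by (simp add: sum_distrib_left)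
    also have "\<dots> \<le> local_const * (C * K\<^sup>2) * (2 * sqrt (real n))"
      using local_const_pos C K by (intro mult_left_mono sum_inverse_sqrt_le) auto
    finally show "(\<Sum>i\<in>{s0<..n}. local_const * (real (card (large_primes L s i)) * (1 + \<Lambda>)) * (1 / sqrt (real i)))
       \<le> local_const * (C * K\<^sup>2) * (2 * sqrt (real n))" .
  qed auto
  also have "\<dots> = (1 + real s0 / real n) * (1 / K\<^sup>2) + 2 * local_const * C * (1 / K ^ 4)"
    unfolding L(2) n(2) of_nat_add using K unfolding n(3) by (simp add: field_simps flip: power_add)
  also have "\<dots> \<le> (1 + real s0) * (1 / K\<^sup>2) + 2 * local_const * C * (1 / K ^ 2)"
  proof (intro add_mono mult_right_mono mult_left_mono)
    show "real s0 / real n \<le> real s0" using n(1) by (simp add: divide_le_eq mult_le_cancel_left1)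
    show "1 / K ^ 4 \<le> 1 / K\<^sup>2" using K by (intro divide_left_mono power_increasing) auto
  qed (use C local_const_pos in auto)
  also have "\<dots> = (1 + real s0 + 2 * local_const * C) / K\<^sup>2" by (simp add: add_divide_distrib)
  finally show "expectation (\<lambda>\<omega>. (\<Sum>i\<in>{s0<..Suc k ^ 12}. \<Sum>p\<in>large_primes (Suc k ^ 2) s i.
      of_bool (int p dvd fst (walk \<xi> i \<omega>) - u)) / real (Suc k ^ 12))
      \<le> (1 + real s0 + 2 * local_const * ((12 + real s0) * (13 + real s0) / ln 2)) / (real (Suc k))\<^sup>2"
    by (simp add: n_def K_def L_def C_def)
qed (auto intro!: sum_nonneg divide_nonneg_nonneg)

section \<open>From sieve frequencies to visibility\<close>

text \<open>The sieve condition is a union of residue classes modulo \<open>N\<close>, each of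
  limiting frequency \<open>1 / N^2\<close>, and \<open>card_avoiding_residues\<close> counts
  them.\<close>

lemma avoids_frequency:
  assumes H: "\<And>N w. N > 0 \<Longrightarrow> (\<lambda>k. hits N w (Suc k ^ 12) \<omega> / real (Suc k ^ 12)) \<longlonglongrightarrow> 1 / (real N)\<^sup>2"
    and F: "finite F" "\<And>p. p \<in> F \<Longrightarrow> prime (p::nat)" and W: "finite W"
    and dist: "\<And>w w' p. w \<in> W \<Longrightarrow> w' \<in> W \<Longrightarrow> w \<noteq> w' \<Longrightarrow> prime p \<Longrightarrow>
       \<not> (int p ^ b1 dvd fst w - fst w' \<and> int p ^ b2 dvd snd w - snd w')"
  shows "(\<lambda>k. (\<Sum>i = 1..Suc k ^ 12. of_bool (avoids b1 b2 W F (walk \<xi> i \<omega>))) / real (Suc k ^ 12))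
     \<longlonglongrightarrow> (\<Prod>p\<in>F. 1 - real (card W) / real p ^ (b1 + b2))"
proof -
  define N where "N = (\<Prod>p\<in>F. p ^ (b1 + b2))"
  have N: "N > 0" unfolding N_def using F prime_gt_0_nat by (intro prod_pos) auto
  have intN: "int N = (\<Prod>p\<in>F. int p ^ (b1 + b2))" by (simp add: N_def)
  define R where "R = {r \<in> {0..<int N} \<times> {0..<int N}. avoids b1 b2 W F r}"
  have dvd: "int p ^ (b1 + b2) dvd int N" if "p \<in> F" for p
    unfolding intN using that F by (intro dvd_prodI) auto
  have "(\<Sum>i = 1..n. of_bool (avoids b1 b2 W F (walk \<xi> i \<omega>))) = (\<Sum>r\<in>R. hits N r n \<omega>)" for n
  proof -
    have "(\<Sum>i = 1..n. of_bool (avoids b1 b2 W F (walk \<xi> i \<omega>)) :: real) =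
       (\<Sum>i = 1..n. \<Sum>r\<in>R. of_bool (int N dvd fst (walk \<xi> i \<omega>) - fst r \<and> int N dvd snd (walk \<xi> i \<omega>) - snd r))"
      unfolding R_def by (intro sum.cong refl avoids_eq_sum_residues N dvd)
    also have "\<dots> = (\<Sum>r\<in>R. hits N r n \<omega>)" unfolding hits_def by (rule sum.swap)
    finally show ?thesis .
  qed
  hence eq: "(\<Sum>i = 1..Suc k ^ 12. of_bool (avoids b1 b2 W F (walk \<xi> i \<omega>))) / real (Suc k ^ 12) =
     (\<Sum>r\<in>R. hits N r (Suc k ^ 12) \<omega> / real (Suc k ^ 12))" for k
    by (simp only: sum_divide_distrib)
  have "(\<lambda>k. \<Sum>r\<in>R. hits N r (Suc k ^ 12) \<omega> / real (Suc k ^ 12)) \<longlonglongrightarrow> (\<Sum>r\<in>R. 1 / (real N)\<^sup>2)"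
    by (intro tendsto_sum H N)
  also have "(\<Sum>r\<in>R. 1 / (real N)\<^sup>2) = real (card R) / (real N)\<^sup>2" by simp
  also have "real (card R) = (real N)\<^sup>2 * (\<Prod>p\<in>F. 1 - real (card W) / real p ^ (b1 + b2))"
  proof -
    have "real_of_int (int N) = real N" by simp
    thus ?thesis using card_avoiding_residues[OF F W dist] unfolding R_def intN[symmetric] by simp
  qed
  also have "\<dots> / (real N)\<^sup>2 = (\<Prod>p\<in>F. 1 - real (card W) / real p ^ (b1 + b2))" using N by simp
  finally show ?thesis unfolding eq .
qed

text \<open>If a point passes the sieve up to \<open>T\<close> but fails to be visible from
  \<open>w\<close>, then the time is at most \<open>s0\<close>, or the point shares a column or row
  with \<open>w\<close>, or some prime above \<open>T\<close> divides both differences, the prime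
  powers being weakened to \<open>p\<close>. Primes up to \<open>L\<close> keep both divisibilities;
  for larger ones the second is encoded in \<open>large_primes\<close>.\<close>

lemma visibility_defect_le:
  fixes \<omega> :: 'a
  assumes b: "b1 \<ge> 1" "b2 \<ge> 1" "coprime b1 b2" and W: "finite W"
    and s0: "\<And>w. w \<in> W \<Longrightarrow> \<bar>fst w + snd w\<bar> \<le> int s0"
  defines "z \<equiv> \<lambda>i. walk \<xi> i \<omega>"
  shows "of_bool (avoids b1 b2 W {p. prime p \<and> p \<le> T} (z i)) - of_bool (\<forall>w\<in>W. b_visible (b1, b2) (z i) w) \<le>
    of_bool (i \<le> s0) + (\<Sum>w\<in>W. of_bool (fst (z i) = fst w) + of_bool (fst (z i) = int i - snd w)
      + (\<Sum>p = Suc T..L. of_bool (int p dvd fst (z i) - fst w \<and> int p dvd snd (z i) - snd w))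
      + (if s0 < i then \<Sum>p\<in>large_primes L (fst w + snd w) i. of_bool (int p dvd fst (z i) - fst w) else (0::real)))"
    (is "?l \<le> of_bool (i \<le> s0) + (\<Sum>w\<in>W. ?t w)")
proof -
  have t0: "0 \<le> ?t w" for w by (intro add_nonneg_nonneg) (auto intro!: sum_nonneg)
  hence sum0: "0 \<le> (\<Sum>w\<in>W. ?t w)" by (intro sum_nonneg)
  show ?thesis
  proof (cases "avoids b1 b2 W {p. prime p \<and> p \<le> T} (z i) \<and> \<not> (\<forall>w\<in>W. b_visible (b1, b2) (z i) w) \<and> s0 < i")
    case False
    have "?l \<le> of_bool (i \<le> s0)" using False by (auto simp: not_less)
    thus ?thesis using sum0 by linarith
  next
    case True
    then obtain w where w: "w \<in> W" "\<not> b_visible (b1, b2) (z i) w" by auto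
    have sum_i: "fst (z i) + snd (z i) = int i" unfolding z_def by (rule fst_plus_snd_walk)
    have nn: "0 \<le> (\<Sum>p = Suc T..L. of_bool (int p dvd fst (z i) - fst w \<and> int p dvd snd (z i) - snd w) :: real)"
       "0 \<le> (\<Sum>p\<in>large_primes L (fst w + snd w) i. of_bool (int p dvd fst (z i) - fst w) :: real)"
      by (auto intro: sum_nonneg)
    have "1 \<le> ?t w"
    proof (cases "fst (z i) = fst w \<or> fst (z i) = int i - snd w")
      case True
      thus ?thesis using nn by (auto intro!: add_nonneg_nonneg add_increasing2)
    next
      case False
      hence ne: "fst (z i) \<noteq> fst w" "snd (z i) \<noteq> snd w" using sum_i by auto
      then obtain p where p: "prime p" "int p ^ b1 dvd fst (z i) - fst w" "int p ^ b2 dvd snd (z i) - snd w"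
        using no_prime_imp_b_visible[OF b ne] w by auto
      have "p > T"
        using True p w by (auto simp: avoids_def not_le[symmetric])
      have d: "int p dvd fst (z i) - fst w" "int p dvd snd (z i) - snd w"
        using p b by (auto intro: dvd_trans[OF dvd_power])
      show ?thesis
      proof (cases "p \<le> L")
        case pL: True
        have "of_bool (int p dvd fst (z i) - fst w \<and> int p dvd snd (z i) - snd w) \<le>
          (\<Sum>p = Suc T..L. of_bool (int p dvd fst (z i) - fst w \<and> int p dvd snd (z i) - snd w) :: real)"
          using pL \<open>p > T\<close> by (intro member_le_sum) auto
        thus ?thesis using d nn by (auto intro!: add_increasing add_increasing2 split: if_splits)
      next
        case pL: False
        \<comment> \<open>Adding the differences removes the randomness, as the coordinates sum to
          \<open>i\<close>.\<close>
        have "int p dvd (fst (z i) - fst w) + (snd (z i) - snd w)" by (intro dvd_add d)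
        also have "(fst (z i) - fst w) + (snd (z i) - snd w) = int i - (fst w + snd w)" using sum_i by simp
        finally have "p \<in> large_primes L (fst w + snd w) i" using p pL by (simp add: large_primes_def)
        hence "of_bool (int p dvd fst (z i) - fst w) \<le>
          (\<Sum>p\<in>large_primes L (fst w + snd w) i. of_bool (int p dvd fst (z i) - fst w) :: real)"
          using large_primes_bound(2)[OF s0[OF w(1)], of i i] True by (intro member_le_sum) auto
        hence "1 \<le> (\<Sum>p\<in>large_primes L (fst w + snd w) i. of_bool (int p dvd fst (z i) - fst w) :: real)"
          using d by simp
        thus ?thesis using True nn(1) by (auto intro!: add_increasing)
      qed
    qed
    also have "?t w \<le> (\<Sum>w\<in>W. ?t w)" using w W t0 by (intro member_le_sum) auto
    finally show ?thesis using True by simp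
  qed
qed

text \<open>On the intersection of the almost sure events the argument is deterministic: the
  frequency of passing the sieve up to \<open>T\<close> is an upper bound, and it exceeds the
  visible frequency by at most \<open>e k + card W / T\<close>.\<close>

lemma AE_visible_frequency_subseq:
  assumes b: "b1 \<ge> 1" "b2 \<ge> 1" "coprime b1 b2" and W: "finite W" "cond_star (b1, b2) W"
  shows "AE \<omega> in M. (\<lambda>k. (\<Sum>i = 1..Suc k ^ 12. of_bool (\<forall>w\<in>W. b_visible (b1, b2) (walk \<xi> i \<omega>) w)) / real (Suc k ^ 12))
     \<longlonglongrightarrow> prodinf (\<lambda>p. if prime p then 1 - real (card W) / real p ^ (b1 + b2) else 1)"
proof -
  define s0 where "s0 = (\<Sum>w\<in>W. nat \<bar>fst w + snd w\<bar>)"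
  have s0: "\<bar>fst w + snd w\<bar> \<le> int s0" if "w \<in> W" for w
  proof -
    have "nat \<bar>fst w + snd w\<bar> \<le> s0" unfolding s0_def using that W by (intro member_le_sum) auto
    thus ?thesis by linarith
  qed
  have dist: "\<not> (int p ^ b1 dvd fst w - fst w' \<and> int p ^ b2 dvd snd w - snd w')"
    if "w \<in> W" "w' \<in> W" "w \<noteq> w'" "prime p" for w w' p
    using W(2) that b by (intro b_visible_imp_no_prime) (auto simp: cond_star_def)
  \<comment> \<open>Countably many moduli and classes share one null set, so every \<open>T\<close>
    is available at once.\<close>
  have "AE \<omega> in M. \<forall>N w. N > 0 \<longrightarrow> (\<lambda>k. hits N w (Suc k ^ 12) \<omega> / real (Suc k ^ 12)) \<longlonglongrightarrow> 1 / (real N)\<^sup>2"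
    unfolding AE_all_countable using AE_hits_frequency by auto
  moreover have "AE \<omega> in M. \<forall>w\<in>W. (\<lambda>k. \<Sum>p = 1..Suc k ^ 2.
      \<bar>hits p w (Suc k ^ 12) \<omega> / real (Suc k ^ 12) - 1 / (real p)\<^sup>2\<bar>) \<longlonglongrightarrow> 0"
    by (intro AE_finite_allI W AE_hits_small_moduli)
  moreover have "AE \<omega> in M. \<forall>w\<in>W. (\<lambda>k. (\<Sum>i = 1..Suc k ^ 12. of_bool (fst (walk \<xi> i \<omega>) = fst w)) / real (Suc k ^ 12)) \<longlonglongrightarrow> 0"
    by (intro AE_finite_allI W AE_line_frequency)
  moreover have "AE \<omega> in M. \<forall>w\<in>W. (\<lambda>k. (\<Sum>i = 1..Suc k ^ 12. of_bool (fst (walk \<xi> i \<omega>) = int i - snd w)) / real (Suc k ^ 12)) \<longlonglongrightarrow> 0"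
    by (intro AE_finite_allI W AE_line_frequency)
  moreover have "AE \<omega> in M. \<forall>w\<in>W. (\<lambda>k. (\<Sum>i\<in>{s0<..Suc k ^ 12}. \<Sum>p\<in>large_primes (Suc k ^ 2) (fst w + snd w) i.
     of_bool (int p dvd fst (walk \<xi> i \<omega>) - fst w)) / real (Suc k ^ 12)) \<longlonglongrightarrow> 0"
    by (intro AE_finite_allI W AE_large_primes_frequency s0)
  ultimately show ?thesis
  proof eventually_elim
    case (elim \<omega>)
    let ?n = "\<lambda>k. Suc k ^ 12"
    define D where "D = (\<lambda>w k. \<Sum>p = 1..Suc k ^ 2. \<bar>hits p w (?n k) \<omega> / real (?n k) - 1 / (real p)\<^sup>2\<bar>)"
    define l1 where "l1 = (\<lambda>(w::int \<times> int) k. (\<Sum>i = 1..?n k. of_bool (fst (walk \<xi> i \<omega>) = fst w)) / real (?n k))"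
    define l2 where "l2 = (\<lambda>(w::int \<times> int) k. (\<Sum>i = 1..?n k. of_bool (fst (walk \<xi> i \<omega>) = int i - snd w)) / real (?n k))"
    define G where "G = (\<lambda>w k. (\<Sum>i\<in>{s0<..?n k}. \<Sum>p\<in>large_primes (Suc k ^ 2) (fst w + snd w) i.
       of_bool (int p dvd fst (walk \<xi> i \<omega>) - fst w)) / real (?n k))"
    \<comment> \<open>All errors that vanish as \<open>k\<close> grows, uniformly in
      \<open>T\<close>; the dependence on \<open>T\<close> is left to the term
      \<open>card W / T\<close>.\<close>
    define e where "e = (\<lambda>k. real s0 / real (?n k) + (\<Sum>w\<in>W. l1 w k + l2 w k + D w k + G w k))"
    define a where "a = (\<lambda>T k. (\<Sum>i = 1..?n k. of_bool (avoids b1 b2 W {p. prime p \<and> p \<le> T} (walk \<xi> i \<omega>))) / real (?n k))"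
    define v where "v = (\<lambda>k. (\<Sum>i = 1..?n k. of_bool (\<forall>w\<in>W. b_visible (b1, b2) (walk \<xi> i \<omega>) w)) / real (?n k))"
    have n0: "real (?n k) > 0" for k by simp
    have "v \<longlonglongrightarrow> prodinf (\<lambda>p. if prime p then 1 - real (card W) / real p ^ (b1 + b2) else 1)"
    proof (rule tendsto_squeeze_family)
      show "a T \<longlonglongrightarrow> (\<Prod>p | prime p \<and> p \<le> T. 1 - real (card W) / real p ^ (b1 + b2))" for T
        unfolding a_def using elim(1) by (intro avoids_frequency W dist) auto
      show "(\<lambda>T. \<Prod>p | prime p \<and> p \<le> T. 1 - real (card W) / real p ^ (b1 + b2)) \<longlonglongrightarrow>
        prodinf (\<lambda>p. if prime p then 1 - real (card W) / real p ^ (b1 + b2) else 1)"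
        using b by (intro prime_product_tendsto) auto
      have "(\<lambda>k. real s0 / real (?n k)) \<longlonglongrightarrow> 0"
      proof (rule tendsto_sandwich[OF _ _ tendsto_const])
        show "\<forall>\<^sub>F k in sequentially. real s0 / real (?n k) \<le> real s0 / real (Suc k)"
        proof (intro always_eventually allI divide_left_mono)
          fix k show "real (Suc k) \<le> real (?n k)" using self_le_power[of "Suc k" 12] by (simp only: of_nat_le_iff)
        qed auto
        show "(\<lambda>k. real s0 / real (Suc k)) \<longlonglongrightarrow> 0" by (rule LIMSEQ_Suc[OF lim_const_over_n])
      qed auto
      moreover have "(\<lambda>k. \<Sum>w\<in>W. l1 w k + l2 w k + D w k + G w k) \<longlonglongrightarrow> (\<Sum>w\<in>W. 0 + 0 + 0 + 0)"
        using elim unfolding l1_def l2_def D_def G_def by (intro tendsto_sum tendsto_add) blast+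
      ultimately show "e \<longlonglongrightarrow> 0" unfolding e_def using tendsto_add by fastforce
      show "v k \<le> a T k" for T k
        unfolding v_def a_def
      proof (intro divide_right_mono sum_mono)
        fix i
        have "avoids b1 b2 W {p. prime p \<and> p \<le> T} (walk \<xi> i \<omega>)" if "\<forall>w\<in>W. b_visible (b1, b2) (walk \<xi> i \<omega>) w"
          unfolding avoids_def using that b b_visible_imp_no_prime by blast
        thus "(of_bool (\<forall>w\<in>W. b_visible (b1, b2) (walk \<xi> i \<omega>) w) :: real) \<le>
           of_bool (avoids b1 b2 W {p. prime p \<and> p \<le> T} (walk \<xi> i \<omega>))" by simp
      qed auto
      show "a T k - e k - real (card W) / real T \<le> v k" if T: "T \<ge> 1" for T k
      proof -
        define n where "n = ?n k"
        define L where "L = Suc k ^ 2"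
        define z where "z = (\<lambda>i. walk \<xi> i \<omega>)"
        have "(\<Sum>i = 1..n. of_bool (avoids b1 b2 W {p. prime p \<and> p \<le> T} (z i)) - of_bool (\<forall>w\<in>W. b_visible (b1, b2) (z i) w)) \<le>
          (\<Sum>i = 1..n. of_bool (i \<le> s0) + (\<Sum>w\<in>W. of_bool (fst (z i) = fst w) + of_bool (fst (z i) = int i - snd w)
            + (\<Sum>p = Suc T..L. of_bool (int p dvd fst (z i) - fst w \<and> int p dvd snd (z i) - snd w))
            + (if s0 < i then \<Sum>p\<in>large_primes L (fst w + snd w) i. of_bool (int p dvd fst (z i) - fst w) else (0::real))))"
          unfolding z_def by (intro sum_mono visibility_defect_le b W s0)
        also have "\<dots> = (\<Sum>i = 1..n. of_bool (i \<le> s0)) + (\<Sum>w\<in>W. (\<Sum>i = 1..n. of_bool (fst (z i) = fst w))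
            + (\<Sum>i = 1..n. of_bool (fst (z i) = int i - snd w)) + (\<Sum>p = Suc T..L. hits p w n \<omega>)
            + (\<Sum>i = 1..n. if s0 < i then \<Sum>p\<in>large_primes L (fst w + snd w) i. of_bool (int p dvd fst (z i) - fst w) else 0))"
        proof -
          have "(\<Sum>i = 1..n. \<Sum>p = Suc T..L. of_bool (int p dvd fst (z i) - fst w \<and> int p dvd snd (z i) - snd w)) =
             (\<Sum>p = Suc T..L. hits p w n \<omega>)" for w
            unfolding hits_def z_def by (rule sum.swap)
          thus ?thesis
            by (subst sum.distrib, subst sum.swap[of _ W]) (simp only: sum.distrib)
        qed
        also have "\<dots> = (\<Sum>i = 1..n. of_bool (i \<le> s0)) + (\<Sum>w\<in>W. real n * l1 w k + real n * l2 w k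
            + (\<Sum>p = Suc T..L. hits p w n \<omega>) + real n * G w k)"
        proof -
          have "(\<Sum>i = 1..n. if s0 < i then f i else 0) = (\<Sum>i\<in>{s0<..n}. f i)" for f :: "nat \<Rightarrow> real"
            by (subst sum.inter_filter[symmetric]) (auto intro!: sum.cong)
          thus ?thesis unfolding l1_def l2_def G_def z_def n_def L_def by (simp del: sum_of_bool_eq)
        qed
        also have "(\<Sum>i = 1..n. of_bool (i \<le> s0)) \<le> real s0"
        proof -
          have "card ({1..n} \<inter> {i. i \<le> s0}) \<le> card {1..s0}" by (intro card_mono) auto
          thus ?thesis by simp
        qed
        also have "(\<Sum>w\<in>W. real n * l1 w k + real n * l2 w k + (\<Sum>p = Suc T..L. hits p w n \<omega>) + real n * G w k) \<le>
           (\<Sum>w\<in>W. real n * l1 w k + real n * l2 w k + real n * (D w k + 1 / real T) + real n * G w k)"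
        proof (intro sum_mono add_mono order_refl)
          fix w
          \<comment> \<open>Each modulus is compared with its expected frequency
            \<open>1 / p^2\<close>. The deviations are part of \<open>D\<close>, which runs over all
            moduli up to \<open>L\<close>, and the expected frequencies beyond \<open>T\<close> sum
            to at most \<open>1 / T\<close>.\<close>
          have "(\<Sum>p = Suc T..L. hits p w n \<omega>) = real n * (\<Sum>p = Suc T..L. hits p w n \<omega> / real n)"
            unfolding sum_divide_distrib[symmetric] by (simp add: n_def)
          also have "(\<Sum>p = Suc T..L. hits p w n \<omega> / real n) \<le>
             (\<Sum>p = Suc T..L. \<bar>hits p w n \<omega> / real n - 1 / (real p)\<^sup>2\<bar> + 1 / (real p)\<^sup>2)"
            by (intro sum_mono) linarith
          also have "\<dots> = (\<Sum>p = Suc T..L. \<bar>hits p w n \<omega> / real n - 1 / (real p)\<^sup>2\<bar>) + (\<Sum>p = Suc T..L. 1 / (real p)\<^sup>2)"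
            by (rule sum.distrib)
          also have "\<dots> \<le> D w k + 1 / real T"
          proof (rule add_mono)
            show "(\<Sum>p = Suc T..L. \<bar>hits p w n \<omega> / real n - 1 / (real p)\<^sup>2\<bar>) \<le> D w k"
              unfolding D_def n_def L_def by (intro sum_mono2) auto
          qed (rule sum_inverse_square_le[OF T])
          finally show "(\<Sum>p = Suc T..L. hits p w n \<omega>) \<le> real n * (D w k + 1 / real T)"
            by (simp add: mult_left_mono)
        qed
        finally have "(\<Sum>i = 1..n. of_bool (avoids b1 b2 W {p. prime p \<and> p \<le> T} (z i)) - of_bool (\<forall>w\<in>W. b_visible (b1, b2) (z i) w)) \<le>
           real s0 + (\<Sum>w\<in>W. real n * l1 w k + real n * l2 w k + real n * (D w k + 1 / real T) + real n * G w k)" by simp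
        also have "(\<Sum>w\<in>W. real n * l1 w k + real n * l2 w k + real n * (D w k + 1 / real T) + real n * G w k) =
           real n * (\<Sum>w\<in>W. l1 w k + l2 w k + D w k + G w k) + real n * (real (card W) / real T)"
          by (simp add: sum.distrib sum_distrib_left algebra_simps)
        also have "real s0 + (real n * (\<Sum>w\<in>W. l1 w k + l2 w k + D w k + G w k) + real n * (real (card W) / real T)) =
           real n * (e k + real (card W) / real T)"
          using n0[of k] by (simp add: e_def n_def algebra_simps)
        also have "(\<Sum>i = 1..n. of_bool (avoids b1 b2 W {p. prime p \<and> p \<le> T} (z i)) - of_bool (\<forall>w\<in>W. b_visible (b1, b2) (z i) w)) =
           real n * (a T k - v k)"
          unfolding sum_subtractf a_def v_def z_def n_def
          by (simp add: right_diff_distrib del: sum_of_bool_eq)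
        finally have "a T k - v k \<le> e k + real (card W) / real T" using n0[of k] by (simp add: n_def)
        thus ?thesis by linarith
      qed
    qed
    thus ?case by (simp add: v_def)
  qed
qed

end

theorem theorem1p1:
  fixes b1 b2 :: nat and \<alpha> :: real and W :: "(int \<times> int) set"
    and M :: "'a measure" and \<xi> :: "nat \<Rightarrow> 'a \<Rightarrow> bool"
  assumes b_pos: "b1 \<ge> 1" "b2 \<ge> 1" and coprime: "gcd b1 b2 = 1"
    and alpha: "0 < \<alpha>" "\<alpha> < 1"
    and W: "finite W" "cond_star (b1, b2) W" "card W < 2 ^ (b1 + b2)"
    and M: "prob_space M"
    and indep: "prob_space.indep_vars M (\<lambda>_. count_space UNIV) \<xi> UNIV"
    and step_prob: "\<And>i. measure M {\<omega> \<in> space M. \<xi> i \<omega>} = \<alpha>"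
  shows "AE \<omega> in M.
     (\<lambda>n. (1 / real n) * (\<Sum>i = 1..n.
        (if (\<forall>w\<in>W. b_visible (b1, b2) (walk \<xi> i \<omega>) w) then 1 else 0 :: real)))
     \<longlonglongrightarrow> prodinf (\<lambda>p. if prime p then 1 - real (card W) / real p ^ (b1 + b2) else 1)"
proof -
  interpret bernoulli_walk M \<xi> \<alpha>
    using M alpha indep step_prob by (intro bernoulli_walk.intro bernoulli_walk_axioms.intro)
  have "coprime b1 b2" using coprime by (simp add: coprime_iff_gcd_eq_1)
  from AE_visible_frequency_subseq[OF b_pos this W(1,2)] show ?thesis
  proof eventually_elim
    case (elim \<omega>)
    have "(\<lambda>n. (\<Sum>i = 1..n. of_bool (\<forall>w\<in>W. b_visible (b1, b2) (walk \<xi> i \<omega>) w)) / real n)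
      \<longlonglongrightarrow> prodinf (\<lambda>p. if prime p then 1 - real (card W) / real p ^ (b1 + b2) else 1)"
    \<comment> \<open>The number of visible times up to \<open>n\<close> is nondecreasing in
      \<open>n\<close>, so the limit along twelfth powers extends to all \<open>n\<close>.\<close>
    proof (rule tendsto_average_of_subseq[OF _ _ _ elim])
      show "(\<Sum>i = 1..m. of_bool (\<forall>w\<in>W. b_visible (b1, b2) (walk \<xi> i \<omega>) w)) \<le>
        (\<Sum>i = 1..n. of_bool (\<forall>w\<in>W. b_visible (b1, b2) (walk \<xi> i \<omega>) w) :: real)" if "m \<le> n" for m n
        using that by (intro sum_mono2) auto
    qed (auto intro: sum_nonneg)
    thus ?case by (simp add: of_bool_def)
  qed
qed

end
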